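(* Let $T=L_{1235}\oplus L_{1245}\oplus L_{1345}\oplus L_{1236}\oplus L_{1256}\oplus L_{1456}\oplus L_{1237}\oplus L_{1267}\oplus L_{1567}$, a basic cluster-tilting object of $\underline{\mathrm{CM}}(B_{4,8})$, and let $\mathbf{g}\in\mathbb{Z}^{9}$ be the vector with coordinates $-1$ at $L_{1245},L_{1236}$, coordinates $1$ at $L_{1456},L_{1267}$, and coordinates $0$ at $L_{1235},L_{1345},L_{1256},L_{1237},L_{1567}$. Then $\mathfrak{e}(t\mathbf{g})>0$ for every positive integer $t$.
   Context: $Q_C$ is the quiver with vertex set $\mathbb{Z}_n$ and arrows $x_i:i-1\to i$, $y_i:i\to i-1$; $B_{k,n}$ is the quotient of the complete path algebra $\widehat{\mathbb{C}Q_C}$ by the relations $xy=yx$, $x^k=y^{n-k}$ (at every vertex, with appropriate subscripts), with center $Z=\mathbb{C}[[t]]$, $t=\sum x_iy_i$. $\mathrm{CM}(B_{k,n})$ is the Frobenius category of $B_{k,n}$-modules free of finite rank over $Z$; $\underline{\mathrm{CM}}(B_{k,n})$ is its stable category, a 2-Calabi–Yau triangulated category with suspension $\Sigma$. For a $k$-subset $I\subset[n]$, $L_I$ is the rank one module with $\mathbb{C}[[t]]$ at each vertex, $x_i$ acting by $1$ if $i\in I$ and by $t$ otherwise, $y_i$ acting by $t$ if $i\in I$ and by $1$ otherwise; $L_{abcd}$ stands for $L_{\{a,b,c,d\}}$. For a basic cluster-tilting object $T=\bigoplus_iT_i$ of $\mathcal{C}=\underline{\mathrm{CM}}(B_{k,n})$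 and an integer vector $\mathbf{g}$ indexed by the summands $T_i$, put $T^{\mathbf{g}_+}=\bigoplus_iT_i^{\max(g_i,0)}$, $T^{\mathbf{g}_-}=\bigoplus_iT_i^{\max(-g_i,0)}$. For $f\in\mathrm{Hom}_{\mathcal{C}}(T^{\mathbf{g}_-},T^{\mathbf{g}_+})$ let $T_f^\bullet$ be the two-term complex $T^{\mathbf{g}_-}\xrightarrow{f}T^{\mathbf{g}_+}$ in $K^b(\mathrm{add}\,T)$. Then $\mathfrak{e}(\mathbf{g})$ is the generic (equivalently minimal) value of $f\mapsto\dim\mathrm{Hom}_{K^b(\mathrm{add}\,T)}(T_f^\bullet,\Sigma T_f^\bullet)$ on $\mathrm{Hom}_{\mathcal{C}}(T^{\mathbf{g}_-},T^{\mathbf{g}_+})$. *)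

theory Defs
  imports
    "HOL-Computational_Algebra.Formal_Power_Series"
    "HOL-Algebra.AbelCoset"
    "HOL-Library.FuncSet"
    "Jordan_Normal_Form.VS_Connect"
begin

section \<open>Quotients of vector spaces and \<open>\<complex>\<close>-linear categories\<close>

text \<open>
  The quotient vector space \<open>V / W\<close>; its elements are the cosets of \<open>W\<close>. The ring fields
  \<^term>\<open>mult\<close> and \<^term>\<open>one\<close> of a \<open>module\<close> record carry no meaning for a module.
\<close>

definition quot_module :: "(complex, 'm) module \<Rightarrow> 'm set \<Rightarrow> (complex, 'm set) module" where
  "quot_module V W =
     \<lparr>carrier = a_rcosets\<^bsub>V\<^esub> W, mult = undefined, one = undefined,
      zero = W, add = set_add V,
      smult = (\<lambda>c A. \<Union>a\<in>A. W +>\<^bsub>V\<^esub> (c \<odot>\<^bsub>V\<^esub> a))\<rparr>"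

text \<open>
  A \<open>\<complex>\<close>-linear category is given by objects, morphism spaces, identities and composition, where
  \<open>Comp \<A> X Y Z g f\<close> is the composite of \<open>f : X \<rightarrow> Y\<close> and \<open>g : Y \<rightarrow> Z\<close>.
\<close>

record ('o, 'm) lincat =
  Obj :: "'o set"
  Mor :: "'o \<Rightarrow> 'o \<Rightarrow> (complex, 'm) module"
  Idn :: "'o \<Rightarrow> 'm"
  Comp :: "'o \<Rightarrow> 'o \<Rightarrow> 'o \<Rightarrow> 'm \<Rightarrow> 'm \<Rightarrow> 'm"

text \<open>The quotient by a two-sided ideal \<open>J\<close> of morphisms.\<close>

definition quot_cat ::
  "('o, 'm) lincat \<Rightarrow> ('o \<Rightarrow> 'o \<Rightarrow> 'm set) \<Rightarrow> ('o, 'm set) lincat" where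
  "quot_cat \<A> J =
     \<lparr>Obj = Obj \<A>,
      Mor = (\<lambda>X Y. quot_module (Mor \<A> X Y) (J X Y)),
      Idn = (\<lambda>X. J X X +>\<^bsub>Mor \<A> X X\<^esub> Idn \<A> X),
      Comp = (\<lambda>X Y Z G F. \<Union>g\<in>G. \<Union>f\<in>F. J X Z +>\<^bsub>Mor \<A> X Z\<^esub> Comp \<A> X Y Z g f)\<rparr>"

definition full_subcat :: "('o, 'm) lincat \<Rightarrow> 'o set \<Rightarrow> ('o, 'm) lincat" where
  "full_subcat \<A> S = \<A>\<lparr>Obj := S\<rparr>"


section \<open>The bounded homotopy category \<open>K\<^sup>b(\<A>)\<close>\<close>

record ('o, 'm) cochain =
  ob :: "int \<Rightarrow> 'o"
  df :: "int \<Rightarrow> 'm"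

definition bounded_complexes :: "('o, 'm) lincat \<Rightarrow> ('o, 'm) cochain set" where
  "bounded_complexes \<A> = {A.
     (\<forall>i. ob A i \<in> Obj \<A> \<and> df A i \<in> carrier (Mor \<A> (ob A i) (ob A (i + 1)))) \<and>
     (\<forall>i. Comp \<A> (ob A i) (ob A (i + 1)) (ob A (i + 1 + 1)) (df A (i + 1)) (df A i)
            = \<zero>\<^bsub>Mor \<A> (ob A i) (ob A (i + 1 + 1))\<^esub>) \<and>
     finite {i. Idn \<A> (ob A i) \<noteq> \<zero>\<^bsub>Mor \<A> (ob A i) (ob A i)\<^esub>}}"

definition chain_maps ::
  "('o, 'm) lincat \<Rightarrow> ('o, 'm) cochain \<Rightarrow> ('o, 'm) cochain \<Rightarrow> (complex, int \<Rightarrow> 'm) module" where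
  "chain_maps \<A> A B =
     \<lparr>carrier = {\<phi>.
        (\<forall>i. \<phi> i \<in> carrier (Mor \<A> (ob A i) (ob B i))) \<and>
        (\<forall>i. Comp \<A> (ob A i) (ob B i) (ob B (i + 1)) (df B i) (\<phi> i)
           = Comp \<A> (ob A i) (ob A (i + 1)) (ob B (i + 1)) (\<phi> (i + 1)) (df A i))},
      mult = undefined, one = undefined,
      zero = (\<lambda>i. \<zero>\<^bsub>Mor \<A> (ob A i) (ob B i)\<^esub>),
      add = (\<lambda>\<phi> \<psi> i. \<phi> i \<oplus>\<^bsub>Mor \<A> (ob A i) (ob B i)\<^esub> \<psi> i),
      smult = (\<lambda>c \<phi> i. c \<odot>\<^bsub>Mor \<A> (ob A i) (ob B i)\<^esub> \<phi> i)\<rparr>"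

definition null_homotopic ::
  "('o, 'm) lincat \<Rightarrow> ('o, 'm) cochain \<Rightarrow> ('o, 'm) cochain \<Rightarrow> (int \<Rightarrow> 'm) set" where
  "null_homotopic \<A> A B = {\<phi>. \<exists>s.
     (\<forall>i. s i \<in> carrier (Mor \<A> (ob A i) (ob B (i - 1)))) \<and>
     (\<forall>i. \<phi> i =
        Comp \<A> (ob A i) (ob B (i - 1)) (ob B i) (df B (i - 1)) (s i)
        \<oplus>\<^bsub>Mor \<A> (ob A i) (ob B i)\<^esub>
        Comp \<A> (ob A i) (ob A (i + 1)) (ob B i) (s (i + 1)) (df A i))}"

definition complex_cat :: "('o, 'm) lincat \<Rightarrow> (('o, 'm) cochain, int \<Rightarrow> 'm) lincat" where
  "complex_cat \<A> =
     \<lparr>Obj = bounded_complexes \<A>,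
      Mor = chain_maps \<A>,
      Idn = (\<lambda>A i. Idn \<A> (ob A i)),
      Comp = (\<lambda>A B C \<psi> \<phi> i. Comp \<A> (ob A i) (ob B i) (ob C i) (\<psi> i) (\<phi> i))\<rparr>"

definition Kb :: "('o, 'm) lincat \<Rightarrow> (('o, 'm) cochain, (int \<Rightarrow> 'm) set) lincat" where
  "Kb \<A> = quot_cat (complex_cat \<A>) (null_homotopic \<A>)"

definition shift :: "('o, 'm) lincat \<Rightarrow> ('o, 'm) cochain \<Rightarrow> ('o, 'm) cochain" where
  "shift \<A> A =
     \<lparr>ob = (\<lambda>i. ob A (i + 1)),
      df = (\<lambda>i. \<ominus>\<^bsub>Mor \<A> (ob A (i + 1)) (ob A (i + 1 + 1))\<^esub> df A (i + 1))\<rparr>"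

text \<open>
  The complex \<open>A \<rightarrow> B\<close> concentrated in degrees \<open>-1\<close> and \<open>0\<close>, with the object \<open>Z\<close> (a zero object
  of the category) in all other degrees.
\<close>

definition two_term :: "('o, 'm) lincat \<Rightarrow> 'o \<Rightarrow> 'o \<Rightarrow> 'o \<Rightarrow> 'm \<Rightarrow> ('o, 'm) cochain" where
  "two_term \<A> Z A B f =
     (let t = (\<lambda>i::int. if i = -1 then A else if i = 0 then B else Z)
      in \<lparr>ob = t, df = (\<lambda>i. if i = -1 then f else \<zero>\<^bsub>Mor \<A> (t i) (t (i + 1))\<^esub>)\<rparr>)"


section \<open>The category \<open>CM(B\<^bsub>k,n\<^esub>)\<close>\<close>

text \<open>
  The vertex set \<open>\<int>/n\<close> of the circular quiver is represented by \<open>{1..n}\<close> (so \<open>n\<close> is the class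
  of \<open>0\<close>), and arrows are indexed by their vertex \<open>i\<close>: \<open>x\<^sub>i : i-1 \<rightarrow> i\<close>, \<open>y\<^sub>i : i \<rightarrow> i-1\<close>.
\<close>

definition vpred :: "nat \<Rightarrow> nat \<Rightarrow> nat" where
  "vpred n i = (if i = 1 then n else i - 1)"

definition vsucc :: "nat \<Rightarrow> nat \<Rightarrow> nat" where
  "vsucc n i = (if i = n then 1 else i + 1)"

text \<open>
  A module that is free of finite rank over \<open>Z = \<complex>[[t]]\<close> is a representation of the quiver in
  free \<open>\<complex>[[t]]\<close>-modules of finite rank (a direct summand \<open>e\<^sub>i M\<close> of a finite free module over
  this local ring is again finite free). We choose bases: vertex \<open>i\<close> carries \<open>\<complex>[[t]]^(rk M i)\<close>,
  and arrows act by matrices multiplying column vectors from the left. Values outside \<open>{1..n}\<close>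
  are irrelevant.
\<close>

record qrep =
  rk :: "nat \<Rightarrow> nat"
  xm :: "nat \<Rightarrow> complex fps mat"
  ym :: "nat \<Rightarrow> complex fps mat"

text \<open>The actions of the paths \<open>x^m\<close> and \<open>y^m\<close> starting at vertex \<open>i\<close>.\<close>

primrec xpath :: "nat \<Rightarrow> qrep \<Rightarrow> nat \<Rightarrow> nat \<Rightarrow> complex fps mat" where
  "xpath n M 0 i = 1\<^sub>m (rk M i)"
| "xpath n M (Suc m) i = xpath n M m (vsucc n i) * xm M (vsucc n i)"

primrec ypath :: "nat \<Rightarrow> qrep \<Rightarrow> nat \<Rightarrow> nat \<Rightarrow> complex fps mat" where
  "ypath n M 0 i = 1\<^sub>m (rk M i)"
| "ypath n M (Suc m) i = ypath n M m (vpred n i) * ym M i"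

text \<open>
  The last conjunct says that the given \<open>\<complex>[[t]]\<close>-structure is the one for which the central
  element \<open>t = \<Sum> x\<^sub>i y\<^sub>i\<close> of the algebra acts as multiplication by \<open>t\<close>.
\<close>

definition CM_modules :: "nat \<Rightarrow> nat \<Rightarrow> qrep set" where
  "CM_modules k n = {M. \<forall>i\<in>{1..n}.
     xm M i \<in> carrier_mat (rk M i) (rk M (vpred n i)) \<and>
     ym M i \<in> carrier_mat (rk M (vpred n i)) (rk M i) \<and>
     xm M i * ym M i = ym M (vsucc n i) * xm M (vsucc n i) \<and>
     xpath n M k i = ypath n M (n - k) i \<and>
     xm M i * ym M i = fps_X \<cdot>\<^sub>m 1\<^sub>m (rk M i)}"

definition qrep_hom :: "nat \<Rightarrow> qrep \<Rightarrow> qrep \<Rightarrow> (complex, nat \<Rightarrow> complex fps mat) module" where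
  "qrep_hom n M N =
     \<lparr>carrier = {\<phi> \<in> (\<Pi>\<^sub>E i\<in>{1..n}. carrier_mat (rk N i) (rk M i)). \<forall>i\<in>{1..n}.
        \<phi> i * xm M i = xm N i * \<phi> (vpred n i) \<and>
        \<phi> (vpred n i) * ym M i = ym N i * \<phi> i},
      mult = undefined, one = undefined,
      zero = (\<lambda>i\<in>{1..n}. 0\<^sub>m (rk N i) (rk M i)),
      add = (\<lambda>\<phi> \<psi>. \<lambda>i\<in>{1..n}. \<phi> i + \<psi> i),
      smult = (\<lambda>c \<phi>. \<lambda>i\<in>{1..n}. fps_const c \<cdot>\<^sub>m \<phi> i)\<rparr>"

definition CM_cat :: "nat \<Rightarrow> nat \<Rightarrow> (qrep, nat \<Rightarrow> complex fps mat) lincat" where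
  "CM_cat k n =
     \<lparr>Obj = CM_modules k n,
      Mor = qrep_hom n,
      Idn = (\<lambda>M. \<lambda>i\<in>{1..n}. 1\<^sub>m (rk M i)),
      Comp = (\<lambda>L M N \<psi> \<phi>. \<lambda>i\<in>{1..n}. \<psi> i * \<phi> i)\<rparr>"

text \<open>
  The projective objects of the Frobenius category \<open>CM(B\<^bsub>k,n\<^esub>)\<close>. Its admissible epimorphisms are
  all surjections, since kernels of maps between finite free \<open>\<complex>[[t]]\<close>-modules are finite free.
\<close>

definition qrep_surj :: "nat \<Rightarrow> qrep \<Rightarrow> qrep \<Rightarrow> (nat \<Rightarrow> complex fps mat) \<Rightarrow> bool" where
  "qrep_surj n M N \<phi> \<longleftrightarrow>
     (\<forall>i\<in>{1..n}. \<forall>v\<in>carrier_vec (rk N i). \<exists>w\<in>carrier_vec (rk M i). \<phi> i *\<^sub>v w = v)"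

definition CM_projective :: "nat \<Rightarrow> nat \<Rightarrow> qrep \<Rightarrow> bool" where
  "CM_projective k n P \<longleftrightarrow> P \<in> CM_modules k n \<and>
     (\<forall>M\<in>CM_modules k n. \<forall>N\<in>CM_modules k n.
        \<forall>\<pi>\<in>carrier (qrep_hom n M N). qrep_surj n M N \<pi> \<longrightarrow>
          (\<forall>\<phi>\<in>carrier (qrep_hom n P N). \<exists>\<psi>\<in>carrier (qrep_hom n P M).
             Comp (CM_cat k n) P M N \<pi> \<psi> = \<phi>))"

definition proj_ideal :: "nat \<Rightarrow> nat \<Rightarrow> qrep \<Rightarrow> qrep \<Rightarrow> (nat \<Rightarrow> complex fps mat) set" where
  "proj_ideal k n M N = {\<phi>. \<exists>P \<alpha> \<beta>. CM_projective k n P \<and>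
     \<alpha> \<in> carrier (qrep_hom n M P) \<and> \<beta> \<in> carrier (qrep_hom n P N) \<and>
     \<phi> = Comp (CM_cat k n) M P N \<beta> \<alpha>}"

definition stable_CM :: "nat \<Rightarrow> nat \<Rightarrow> (qrep, (nat \<Rightarrow> complex fps mat) set) lincat" where
  "stable_CM k n = quot_cat (CM_cat k n) (proj_ideal k n)"

definition dsum :: "qrep list \<Rightarrow> qrep" where
  "dsum Ms =
     \<lparr>rk = (\<lambda>i. sum_list (map (\<lambda>M. rk M i) Ms)),
      xm = (\<lambda>i. diag_block_mat (map (\<lambda>M. xm M i) Ms)),
      ym = (\<lambda>i. diag_block_mat (map (\<lambda>M. ym M i) Ms))\<rparr>"

definition rank_one :: "nat set \<Rightarrow> qrep" where
  "rank_one I =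
     \<lparr>rk = (\<lambda>i. 1),
      xm = (\<lambda>i. (if i \<in> I then 1 else fps_X) \<cdot>\<^sub>m 1\<^sub>m 1),
      ym = (\<lambda>i. (if i \<in> I then fps_X else 1) \<cdot>\<^sub>m 1\<^sub>m 1)\<rparr>"


section \<open>The generic \<open>E\<close>-invariant of a vector \<open>g\<close>\<close>

text \<open>
  The list \<open>Ts\<close> consists of the indecomposable summands of \<open>T\<close>, and the vector \<open>g\<close> is listed in
  the same order.
\<close>

definition T_pos :: "qrep list \<Rightarrow> int list \<Rightarrow> qrep" where
  "T_pos Ts g = dsum (concat (map2 (\<lambda>M a. replicate (nat (max a 0)) M) Ts g))"

definition T_neg :: "qrep list \<Rightarrow> int list \<Rightarrow> qrep" where
  "T_neg Ts g = dsum (concat (map2 (\<lambda>M a. replicate (nat (max (- a) 0)) M) Ts g))"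

text \<open>\<open>add T\<close>: the direct summands, in the stable category, of the finite direct sums \<open>T\<^sup>m\<close>.\<close>

definition add_cat ::
  "nat \<Rightarrow> nat \<Rightarrow> qrep \<Rightarrow> (qrep, (nat \<Rightarrow> complex fps mat) set) lincat" where
  "add_cat k n T = full_subcat (stable_CM k n) {M \<in> Obj (stable_CM k n).
     \<exists>m. \<exists>\<iota>\<in>carrier (Mor (stable_CM k n) M (dsum (replicate m T))).
         \<exists>\<pi>\<in>carrier (Mor (stable_CM k n) (dsum (replicate m T)) M).
           Comp (stable_CM k n) M (dsum (replicate m T)) M \<pi> \<iota> = Idn (stable_CM k n) M}"

definition T_cx ::
  "nat \<Rightarrow> nat \<Rightarrow> qrep list \<Rightarrow> int list \<Rightarrow> (nat \<Rightarrow> complex fps mat) set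
     \<Rightarrow> (qrep, (nat \<Rightarrow> complex fps mat) set) cochain" where
  "T_cx k n Ts g f = two_term (add_cat k n (dsum Ts)) (dsum []) (T_neg Ts g) (T_pos Ts g) f"

definition E_dim ::
  "nat \<Rightarrow> nat \<Rightarrow> qrep list \<Rightarrow> int list \<Rightarrow> (nat \<Rightarrow> complex fps mat) set \<Rightarrow> nat" where
  "E_dim k n Ts g f =
     vectorspace.dim (class_ring :: complex ring)
       (Mor (Kb (add_cat k n (dsum Ts))) (T_cx k n Ts g f)
          (shift (add_cat k n (dsum Ts)) (T_cx k n Ts g f)))"

text \<open>The generic value is the minimal one, since \<^term>\<open>E_dim k n Ts g\<close> is upper semicontinuous.\<close>

definition e_inv :: "nat \<Rightarrow> nat \<Rightarrow> qrep list \<Rightarrow> int list \<Rightarrow> nat" where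
  "e_inv k n Ts g =
     (INF f \<in> carrier (Mor (stable_CM k n) (T_neg Ts g) (T_pos Ts g)). E_dim k n Ts g f)"


section \<open>The cluster-tilting object and the vector for \<open>(k, n) = (4, 8)\<close>\<close>

definition T_labels :: "nat set list" where
  "T_labels =
     [{1,2,3,5}, {1,2,4,5}, {1,3,4,5},
      {1,2,3,6}, {1,2,5,6}, {1,4,5,6},
      {1,2,3,7}, {1,2,6,7}, {1,5,6,7}]"

definition g_coord :: "nat set \<Rightarrow> int" where
  "g_coord I =
     (if I \<in> {{1,2,4,5}, {1,2,3,6}} then -1
      else if I \<in> {{1,4,5,6}, {1,2,6,7}} then 1 else 0)"

end

theory Submission
  imports Defs
begin

text \<open>
  Sending a homomorphism to the constant terms of its matrix at the vertex \<open>8\<close> identifies the stable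
  space of maps \<open>L\<^sub>1\<^sub>2\<^sub>4\<^sub>5\<^sup>t \<oplus> L\<^sub>1\<^sub>2\<^sub>3\<^sub>6\<^sup>t \<rightarrow> L\<^sub>1\<^sub>4\<^sub>5\<^sub>6\<^sup>t \<oplus> L\<^sub>1\<^sub>2\<^sub>6\<^sub>7\<^sup>t\<close>
  with the complex \<open>2t \<times> 2t\<close> matrices. Endomorphisms of the two sides are sent to block diagonal
  matrices, since every map between the two different summands of one side vanishes there. For a map
  with matrix \<open>F\<close> the null-homotopic chain maps are therefore contained in the image of
  \<open>(a, b) \<mapsto> b F - F a\<close> on pairs of block diagonal matrices. Source and target of this linear map
  both have dimension \<open>4t\<^sup>2\<close>, and the pair of identity matrices lies in its kernel, so it is not
  surjective.
\<close>

section \<open>Images and quotients of vector spaces\<close>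

text \<open>The module with label \<open>{1..4}\<close> is the projective generated at vertex 8. A
  homomorphism from a source summand to a target summand is determined by its power series at vertex
  8, and every series occurs. Multiples of \<open>t\<close> factor through this projective.
  Conversely, a map from a projective to a target lifts to a cover by the projectives at the
  vertices 8, 3 and 5; only the first of these reaches the target with a unit at vertex 8, and no
  source summand maps to it with a nonzero constant term there. Hence exactly the constant term
  survives stably. Cut into blocks of size \<open>t\<close>, the matrix \<open>F\<close> is a
  representation of the quiver with two sources, two sinks and one arrow from each source to each
  sink, of dimension vector \<open>(t, t, t, t)\<close>. This is a cycle of affine type A3 whose
  Tits form vanishes on this vector; that is why the two dimensions agree for every \<open>t\<close>
  and why the scalars already prevent a dense orbit. The formal obstacle is that stable spaces,
  homotopy classes and their composites are given as bare sets of cosets, so each has to be brought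
  back to matrices before any linear algebra applies.\<close>

lemma vectorspace_surj_image:
  assumes V: "vectorspace K V"
    and car: "carrier Q = f ` carrier V"
    and zero: "\<zero>\<^bsub>Q\<^esub> = f \<zero>\<^bsub>V\<^esub>"
    and add: "\<And>v w. v \<in> carrier V \<Longrightarrow> w \<in> carrier V \<Longrightarrow> f v \<oplus>\<^bsub>Q\<^esub> f w = f (v \<oplus>\<^bsub>V\<^esub> w)"
    and smult: "\<And>c v. c \<in> carrier K \<Longrightarrow> v \<in> carrier V \<Longrightarrow> c \<odot>\<^bsub>Q\<^esub> f v = f (c \<odot>\<^bsub>V\<^esub> v)"
  shows "vectorspace K Q" "linear_map K V Q f"
proof -
  interpret V: vectorspace K V by (rule V)
  \<comment> \<open>Every law of \<open>Q\<close> is the image under \<open>f\<close> of the same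
    law in \<open>V\<close>. This treats cosets, chain maps and the stable space in one go.\<close>
  have "abelian_group Q"
  proof (rule abelian_groupI)
    fix x assume "x \<in> carrier Q"
    then obtain v where v: "v \<in> carrier V" "x = f v" using car by auto
    then have "f (\<ominus>\<^bsub>V\<^esub> v) \<in> carrier Q" "f (\<ominus>\<^bsub>V\<^esub> v) \<oplus>\<^bsub>Q\<^esub> x = \<zero>\<^bsub>Q\<^esub>"
      by (auto simp: car zero add V.M.l_neg)
    then show "\<exists>y\<in>carrier Q. y \<oplus>\<^bsub>Q\<^esub> x = \<zero>\<^bsub>Q\<^esub>" by blast
  qed (auto simp: car zero add V.M.a_assoc V.M.a_comm V.M.a_lcomm)
  then have "Module.module K Q"
    by (intro Module.module.intro Module.module_axioms.intro V.R.is_cring)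
      (auto simp: car add smult V.smult_l_distr V.smult_r_distr V.smult_assoc1)
  then show Q: "vectorspace K Q"
    by (intro vectorspace.intro V.field_axioms)
  interpret Q: vectorspace K Q by (rule Q)
  show "linear_map K V Q f"
    by (intro linear_map.intro mod_hom.intro mod_hom_axioms.intro V Q V.module_axioms Q.module_axioms)
      (auto simp: module_hom_def car add smult)
qed

text \<open>\<open>vectorspace.dim\<close> has its intended meaning only in finite dimension, so
  finiteness is first carried over from \<open>V\<close>; then a nontrivial carrier forces a
  nonempty basis.\<close>

lemma dim_pos_if_surj_image:
  assumes V: "vectorspace K V" and fin: "vectorspace.fin_dim K V"
    and f: "linear_map K V Q f" and surj: "carrier Q = f ` carrier V"
    and nontriv: "carrier Q \<noteq> {\<zero>\<^bsub>Q\<^esub>}"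
  shows "vectorspace.dim K Q > 0"
proof -
  interpret f: linear_map K V Q f by (rule f)
  have fd: "f.W.fin_dim"
    by (rule f.surj_fin_dim[OF fin]) (use surj in auto)
  then obtain A where A: "finite A" "f.W.basis A" by (metis f.W.finite_basis_exists)
  then have "f.W.dim = card A" by (rule f.W.dim_basis)
  moreover have "A \<noteq> {}"
  proof
    assume "A = {}"
    with A have "f.W.module.span {} = carrier Q" by (simp add: f.W.basis_def)
    moreover have "f.W.module.span {} = {\<zero>\<^bsub>Q\<^esub>}" by (simp add: f.W.span_empty)
    ultimately show False using nontriv by simp
  qed
  ultimately show ?thesis using A(1) by (simp add: card_gt_0_iff)
qed

lemma surj_endo_kernel_trivial:
  assumes "linear_map K V V T" "vectorspace.fin_dim K V" "T ` carrier V = carrier V"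
    and v: "v \<in> carrier V" "T v = \<zero>\<^bsub>V\<^esub>"
  shows "v = \<zero>\<^bsub>V\<^esub>"
  \<comment> \<open>Otherwise extend \<open>v\<close> to a basis: the images of the other basis vectors would generate \<open>V\<close>.\<close>
proof (rule ccontr)
  assume nz: "v \<noteq> \<zero>\<^bsub>V\<^esub>"
  interpret T: linear_map K V V T by fact
  have li: "T.V.module.lin_indpt {v}"
    using nz v(1) T.V.lindep_span[of "{v}"] by (simp add: T.V.span_empty)
  obtain B where B: "finite B" "T.V.basis B" using assms(2) T.V.finite_basis_exists by metis
  then have B': "B \<subseteq> carrier V" "T.V.module.span B = carrier V" "card B = T.V.dim"
    using T.V.dim_basis by (auto simp: T.V.basis_def)
  obtain C where C: "finite C" "C \<subseteq> carrier V" "int (card C) \<le> int (card B) - int (card {v})"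
      "T.V.module.span ({v} \<union> C) = T.V.module.span B"
    using T.V.replacement[of "{v}" B] v li B B' by auto
  \<comment> \<open>The preimage of the span of the image of \<open>C\<close>. It is a submodule
    containing \<open>C\<close>, and also \<open>v\<close> because \<open>T v\<close> is zero; so it
    is all of \<open>V\<close>.\<close>
  define N where "N = {u \<in> carrier V. T u \<in> T.V.module.span (T ` C)}"
  have TC: "T ` C \<subseteq> carrier V" using C(2) by auto
  have "submodule K (T.V.module.span (T ` C)) V" by (rule T.V.module.span_is_submodule[OF TC])
  then have "submodule K N V"
    unfolding N_def submodule_def by auto
  moreover have "{v} \<union> C \<subseteq> N"
    using v C(2) T.V.module.in_own_span[OF TC] \<open>submodule K (T.V.module.span (T ` C)) V\<close>
    by (auto simp: N_def submodule_def)
  ultimately have "T.V.module.span ({v} \<union> C) \<subseteq> N" by (rule T.V.module.span_is_subset[rotated])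
  then have "T ` carrier V \<subseteq> T.V.module.span (T ` C)"
    unfolding C(4) B'(2) N_def by blast
  then have "carrier V \<subseteq> T.V.module.span (T ` C)" unfolding assms(3) .
  then have "T.V.module.span (T ` C) = carrier V"
    using T.V.module.span_is_subset2[OF TC] by auto
  then have "T.V.dim \<le> card (T ` C)"
    by (intro T.V.gen_ge_dim) (use TC C(1) in auto)
  also have "\<dots> \<le> card C" by (rule card_image_le[OF C(1)])
  finally show False using C(3) B'(3) by simp
qed

section \<open>Quotients of complex vector spaces by subspaces\<close>

locale quotient_vectorspace =
  fixes V :: "(complex, 'm) module" and W :: "'m set"
  assumes vs: "vectorspace (class_ring :: complex ring) V"
    and sub: "W \<subseteq> carrier V"
    and zero_in: "\<zero>\<^bsub>V\<^esub> \<in> W"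
    and add_in: "\<And>v w. v \<in> W \<Longrightarrow> w \<in> W \<Longrightarrow> v \<oplus>\<^bsub>V\<^esub> w \<in> W"
    and smult_in: "\<And>c v. v \<in> W \<Longrightarrow> c \<odot>\<^bsub>V\<^esub> v \<in> W"
begin

sublocale V: vectorspace "class_ring :: complex ring" V by (rule vs)

lemma smult_closed: "v \<in> carrier V \<Longrightarrow> c \<odot>\<^bsub>V\<^esub> v \<in> carrier V"
  by (rule V.smult_closed) auto

lemma minus_in: "v \<in> W \<Longrightarrow> \<ominus>\<^bsub>V\<^esub> v \<in> W"
proof -
  assume v: "v \<in> W"
  have "\<ominus>\<^bsub>V\<^esub> v = (\<ominus>\<^bsub>(class_ring :: complex ring)\<^esub> \<one>\<^bsub>(class_ring :: complex ring)\<^esub>) \<odot>\<^bsub>V\<^esub> v"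
    using v sub by (metis V.smult_minus_1 subsetD)
  with smult_in[OF v] show ?thesis by simp
qed

lemma abelian_subgroup: "abelian_subgroup W V"
  by (rule abelian_subgroupI3)
    (auto intro!: additive_subgroup.intro subgroup.intro V.M.abelian_group_axioms
      simp: sub[THEN subsetD] zero_in add_in minus_in a_inv_def[symmetric])

sublocale S: abelian_subgroup W V by (rule abelian_subgroup)

lemma carrier_quot: "carrier (quot_module V W) = (\<lambda>v. W +>\<^bsub>V\<^esub> v) ` carrier V"
  by (auto simp: quot_module_def A_RCOSETS_def')

lemma zero_quot: "\<zero>\<^bsub>quot_module V W\<^esub> = W +>\<^bsub>V\<^esub> \<zero>\<^bsub>V\<^esub>"
  by (simp add: quot_module_def S.a_subset V.M.a_coset_add_zero)

lemma add_quot: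
  "v \<in> carrier V \<Longrightarrow> w \<in> carrier V \<Longrightarrow>
    (W +>\<^bsub>V\<^esub> v) \<oplus>\<^bsub>quot_module V W\<^esub> (W +>\<^bsub>V\<^esub> w) = W +>\<^bsub>V\<^esub> (v \<oplus>\<^bsub>V\<^esub> w)"
  by (simp add: quot_module_def S.a_rcos_sum)

lemma mem_coset: "w \<in> W +>\<^bsub>V\<^esub> v \<longleftrightarrow> (\<exists>j\<in>W. w = j \<oplus>\<^bsub>V\<^esub> v)"
  by (auto simp: a_r_coset_def')

lemma coset_add_eq: "j \<in> W \<Longrightarrow> v \<in> carrier V \<Longrightarrow> W +>\<^bsub>V\<^esub> (j \<oplus>\<^bsub>V\<^esub> v) = W +>\<^bsub>V\<^esub> v"
  by (rule S.a_repr_independence'[symmetric]) (auto simp: mem_coset)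

lemma coset_eq_iff:
  assumes "v \<in> carrier V" "w \<in> carrier V"
  shows "W +>\<^bsub>V\<^esub> v = W +>\<^bsub>V\<^esub> w \<longleftrightarrow> (\<exists>j\<in>W. v = j \<oplus>\<^bsub>V\<^esub> w)"
  using assms coset_add_eq S.a_rcos_self mem_coset by metis

text \<open>Scalar multiplication of cosets is defined as a union over all representatives. Two
  representatives differ by an element of \<open>W\<close>, and \<open>W\<close> is stable under
  scalars, so all members of the union are the same coset.\<close>

lemma smult_quot:
  assumes "v \<in> carrier V"
  shows "c \<odot>\<^bsub>quot_module V W\<^esub> (W +>\<^bsub>V\<^esub> v) = W +>\<^bsub>V\<^esub> (c \<odot>\<^bsub>V\<^esub> v)"
proof -
  have "W +>\<^bsub>V\<^esub> (c \<odot>\<^bsub>V\<^esub> a) = W +>\<^bsub>V\<^esub> (c \<odot>\<^bsub>V\<^esub> v)" if a: "a \<in> W +>\<^bsub>V\<^esub> v" for a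
  proof -
    from a obtain j where j: "j \<in> W" "a = j \<oplus>\<^bsub>V\<^esub> v" by (auto simp: mem_coset)
    then have "c \<odot>\<^bsub>V\<^esub> a = c \<odot>\<^bsub>V\<^esub> j \<oplus>\<^bsub>V\<^esub> c \<odot>\<^bsub>V\<^esub> v"
      using assms sub by (auto intro!: V.smult_r_distr)
    then show ?thesis using j assms by (simp add: coset_add_eq smult_in smult_closed)
  qed
  moreover have "v \<in> W +>\<^bsub>V\<^esub> v" using assms by (rule S.a_rcos_self)
  ultimately have "(\<Union>a\<in>W +>\<^bsub>V\<^esub> v. W +>\<^bsub>V\<^esub> (c \<odot>\<^bsub>V\<^esub> a)) = W +>\<^bsub>V\<^esub> (c \<odot>\<^bsub>V\<^esub> v)"
    by blast
  then show ?thesis unfolding quot_module_def by simp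
qed

lemma quot:
  "vectorspace class_ring (quot_module V W)"
  "linear_map class_ring V (quot_module V W) (\<lambda>v. W +>\<^bsub>V\<^esub> v)"
proof -
  note * = carrier_quot zero_quot
  show "vectorspace class_ring (quot_module V W)"
    by (rule vectorspace_surj_image(1)[OF vs *]) (simp_all only: add_quot smult_quot)
  show "linear_map class_ring V (quot_module V W) (\<lambda>v. W +>\<^bsub>V\<^esub> v)"
    by (rule vectorspace_surj_image(2)[OF vs *]) (simp_all only: add_quot smult_quot)
qed

lemma quot_nontrivial:
  assumes "W \<noteq> carrier V"
  shows "carrier (quot_module V W) \<noteq> {\<zero>\<^bsub>quot_module V W\<^esub>}"
proof
  assume *: "carrier (quot_module V W) = {\<zero>\<^bsub>quot_module V W\<^esub>}"
  have "v \<in> W" if v: "v \<in> carrier V" for v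
  proof -
    have "W +>\<^bsub>V\<^esub> v \<in> carrier (quot_module V W)" using v carrier_quot by auto
    with * have "W +>\<^bsub>V\<^esub> v = W" by (simp add: quot_module_def)
    with S.a_rcos_self[OF v] show ?thesis by simp
  qed
  with sub assms show False by auto
qed

end

section \<open>Block diagonal matrices\<close>

text \<open>Matrices are a linear image of the vectors of length \<open>nr * nc\<close>, read row by
  row, and surjective linear maps preserve finite dimension.\<close>

lemma fin_dim_module_mat:
  "vectorspace.fin_dim (class_ring :: 'a :: field ring) (module_mat TYPE('a) nr nc)"
proof -
  interpret v: vec_space "TYPE('a)" "nr * nc" .
  let ?f = "\<lambda>v :: 'a vec. mat nr nc (\<lambda>(i,j). v $ (i * nc + j))"
  have ix: "i * nc + j < nr * nc" if "i < nr" "j < nc" for i j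
  proof -
    have "i * nc + j < Suc i * nc" using that by simp
    also have "\<dots> \<le> nr * nc" using that by (intro mult_le_mono1) simp
    finally show ?thesis .
  qed
  have lin: "linear_map (class_ring :: 'a ring) (module_vec TYPE('a) (nr * nc)) (module_mat TYPE('a) nr nc) ?f"
    by (intro linear_map.intro mod_hom.intro mod_hom_axioms.intro matrix_vs v.vectorspace_axioms
        vectorspace.axioms(1)[OF matrix_vs] vectorspace.axioms(1)[OF v.vectorspace_axioms])
      (auto simp: module_hom_def module_mat_simps module_vec_simps ix)
  have surj: "?f ` carrier_vec (nr * nc) = carrier_mat nr nc"
  proof (intro equalityI subsetI)
    fix A :: "'a mat" assume A: "A \<in> carrier_mat nr nc"
    have "A = ?f (vec (nr * nc) (\<lambda>k. A $$ (k div nc, k mod nc)))"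
    proof (rule eq_matI)
      fix i j assume "i < dim_row (?f (vec (nr * nc) (\<lambda>k. A $$ (k div nc, k mod nc))))"
        "j < dim_col (?f (vec (nr * nc) (\<lambda>k. A $$ (k div nc, k mod nc))))"
      then have ij: "i < nr" "j < nc" by auto
      then have "(i * nc + j) div nc = i" "(i * nc + j) mod nc = j" by auto
      with ij ix[OF ij] show "A $$ (i, j) = ?f (vec (nr * nc) (\<lambda>k. A $$ (k div nc, k mod nc))) $$ (i, j)"
        by simp
    qed (use A in auto)
    then show "A \<in> ?f ` carrier_vec (nr * nc)" by (rule image_eqI) simp
  qed auto
  show ?thesis
    by (rule linear_map.surj_fin_dim[OF lin]) (use surj in \<open>auto simp: module_mat_simps module_vec_simps\<close>)
qed

lemma add_minus_interchange_mat:
  fixes P :: "'a :: ab_group_add mat"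
  assumes "P \<in> carrier_mat r c" "Q \<in> carrier_mat r c" "R \<in> carrier_mat r c" "S \<in> carrier_mat r c"
  shows "(P + Q) - (R + S) = (P - R) + (Q - S)"
  using assms by (intro eq_matI) auto

lemma smult_minus_distrib_mat:
  fixes P :: "'a :: comm_ring mat"
  assumes "P \<in> carrier_mat r c" "R \<in> carrier_mat r c"
  shows "x \<cdot>\<^sub>m (P - R) = x \<cdot>\<^sub>m P - x \<cdot>\<^sub>m R"
  using assms by (intro eq_matI) (auto simp: algebra_simps)

lemma neg_smult_add_mat:
  fixes P :: "'a :: comm_ring_1 mat"
  assumes "P \<in> carrier_mat r c" "R \<in> carrier_mat r c"
  shows "(-1) \<cdot>\<^sub>m P + R = R - P"
  using assms by (intro eq_matI) auto

definition block_diag :: "nat \<Rightarrow> complex mat \<Rightarrow> bool" where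
  "block_diag t a \<longleftrightarrow> a \<in> carrier_mat (2 * t) (2 * t) \<and>
     (\<forall>p<2 * t. \<forall>q<2 * t. (p < t) \<noteq> (q < t) \<longrightarrow> a $$ (p, q) = 0)"

text \<open>
  A pair of block diagonal matrices is stored in a single matrix, the second member of the pair in
  the off-diagonal blocks. This turns \<open>(a, b) \<mapsto> b F - F a\<close> into an endomorphism, and its kernel
  contains the pair of identity matrices.
\<close>

lemma block_diag_commutators_not_surj:
  fixes F :: "complex mat"
  assumes F: "F \<in> carrier_mat (2 * t) (2 * t)" and t: "t > 0"
  shows "\<exists>X\<in>carrier_mat (2 * t) (2 * t). \<forall>a b. block_diag t a \<longrightarrow> block_diag t b \<longrightarrow> b * F - F * a \<noteq> X"
proof (rule ccontr)
  assume contr: "\<not> ?thesis"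
  let ?m = "2 * t"
  let ?V = "module_mat TYPE(complex) ?m ?m"
  \<comment> \<open>\<open>sw\<close> exchanges the two halves of the column indices. It carries the
    diagonal blocks to the off-diagonal ones, where the second matrix of the pair is stored.\<close>
  define sw where "sw q = (if q < t then q + t else q - t)" for q
  define A :: "complex mat \<Rightarrow> complex mat"
    where "A c = mat ?m ?m (\<lambda>(p,q). if (p < t) = (q < t) then c $$ (p, q) else 0)" for c
  define B :: "complex mat \<Rightarrow> complex mat"
    where "B c = mat ?m ?m (\<lambda>(p,q). if (p < t) = (q < t) then c $$ (p, sw q) else 0)" for c
  define T where "T c = B c * F - F * A c" for c
  have sw: "q < ?m \<Longrightarrow> sw q < ?m" "q < ?m \<Longrightarrow> sw (sw q) = q"
    "q < ?m \<Longrightarrow> (sw q < t) = (\<not> q < t)" for q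
    by (auto simp: sw_def)
  have AB[simp]: "A c \<in> carrier_mat ?m ?m" "B c \<in> carrier_mat ?m ?m" for c
    by (auto simp: A_def B_def)
  have T[simp]: "T c \<in> carrier_mat ?m ?m" for c unfolding T_def
    by (intro minus_carrier_mat mult_carrier_mat[OF F AB(1)])
  have BF: "B c * F \<in> carrier_mat ?m ?m" and FA: "F * A c \<in> carrier_mat ?m ?m" for c
    by (rule mult_carrier_mat[OF AB(2) F] mult_carrier_mat[OF F AB(1)])+
  have A_add: "A (c + d) = A c + A d" and B_add: "B (c + d) = B c + B d"
    if "c \<in> carrier_mat ?m ?m" "d \<in> carrier_mat ?m ?m" for c d
    using that by (auto simp: A_def B_def sw intro!: eq_matI)
  have A_sm: "A (x \<cdot>\<^sub>m c) = x \<cdot>\<^sub>m A c" and B_sm: "B (x \<cdot>\<^sub>m c) = x \<cdot>\<^sub>m B c"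
    if "c \<in> carrier_mat ?m ?m" for x c
    using that by (auto simp: A_def B_def sw intro!: eq_matI)
  have T_add: "T (c + d) = T c + T d"
    if cd: "c \<in> carrier_mat ?m ?m" "d \<in> carrier_mat ?m ?m" for c d
  proof -
    have "T (c + d) = (B c * F + B d * F) - (F * A c + F * A d)"
      unfolding T_def A_add[OF cd] B_add[OF cd]
      using add_mult_distrib_mat[OF AB(2,2) F] mult_add_distrib_mat[OF F AB(1,1)] by simp
    also have "\<dots> = T c + T d"
      unfolding T_def by (rule add_minus_interchange_mat[OF BF BF FA FA])
    finally show ?thesis .
  qed
  have T_sm: "T (x \<cdot>\<^sub>m c) = x \<cdot>\<^sub>m T c" if c: "c \<in> carrier_mat ?m ?m" for x c
  proof -
    have "T (x \<cdot>\<^sub>m c) = x \<cdot>\<^sub>m (B c * F) - x \<cdot>\<^sub>m (F * A c)"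
      unfolding T_def A_sm[OF c] B_sm[OF c]
      using mult_smult_assoc_mat[OF AB(2) F] mult_smult_distrib[OF F AB(1)] by simp
    also have "\<dots> = x \<cdot>\<^sub>m T c"
      unfolding T_def by (rule smult_minus_distrib_mat[OF BF FA, symmetric])
    finally show ?thesis .
  qed
  have lin: "linear_map class_ring ?V ?V T"
    by (intro linear_map.intro mod_hom.intro mod_hom_axioms.intro matrix_vs vectorspace.axioms(1)[OF matrix_vs])
      (auto simp: module_hom_def module_mat_simps T_add T_sm)
  have surj: "T ` carrier ?V = carrier ?V"
  proof (intro equalityI subsetI)
    fix X assume "X \<in> carrier ?V"
    then have "X \<in> carrier_mat ?m ?m" by (simp add: module_mat_simps)
    with contr obtain a b where ab: "block_diag t a" "block_diag t b" "b * F - F * a = X" by blast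
    define c where "c = mat ?m ?m (\<lambda>(p,q). if (p < t) = (q < t) then a $$ (p, q) else b $$ (p, sw q))"
    have "A c = a" "B c = b"
      using ab by (auto simp: A_def B_def c_def block_diag_def sw intro!: eq_matI)
    then have "T c = X" using ab by (simp add: T_def)
    moreover have "c \<in> carrier ?V" by (simp add: module_mat_simps c_def)
    ultimately show "X \<in> T ` carrier ?V" by blast
  qed (auto simp: module_mat_simps)
  \<comment> \<open>The entries with \<open>p = q\<close> store the first identity matrix and those
    with \<open>p = sw q\<close> the second. Positivity of \<open>t\<close> provides the entry at
    \<open>(0,0)\<close>, which shows that this matrix is nonzero.\<close>
  define c0 :: "complex mat" where "c0 = mat ?m ?m (\<lambda>(p,q). if p = q \<or> p = sw q then 1 else 0)"
  have c0: "c0 \<in> carrier ?V" by (simp add: module_mat_simps c0_def)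
  have "A c0 = 1\<^sub>m ?m" "B c0 = 1\<^sub>m ?m"
    using sw by (auto simp: A_def B_def c0_def intro!: eq_matI)
  then have "T c0 = 0\<^sub>m ?m ?m" using F by (simp add: T_def)
  then have "c0 = 0\<^sub>m ?m ?m"
    using surj_endo_kernel_trivial[OF lin fin_dim_module_mat surj c0] by (simp add: module_mat_simps)
  then have "c0 $$ (0,0) = 0" using t by simp
  then show False using t by (simp add: c0_def)
qed

section \<open>Representations of the circular quiver\<close>

lemma vpred_in: "i \<in> {1..n} \<Longrightarrow> vpred n i \<in> {1..n}"
  by (auto simp: vpred_def)

lemma vsucc_in: "i \<in> {1..n} \<Longrightarrow> vsucc n i \<in> {1..n}"
  by (auto simp: vsucc_def)

text \<open>The matrix sizes suffice for composing homomorphisms and for their linear structure, and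
  they hold for every sum of rank one modules without looking at the labels. Membership in
  \<open>CM_modules\<close> is then established only for the modules that take part in a lifting
  problem.\<close>

definition sized :: "nat \<Rightarrow> qrep \<Rightarrow> bool" where
  "sized n M \<longleftrightarrow> (\<forall>i\<in>{1..n}. xm M i \<in> carrier_mat (rk M i) (rk M (vpred n i)) \<and>
     ym M i \<in> carrier_mat (rk M (vpred n i)) (rk M i))"

lemma sized_if_CM: "M \<in> CM_modules k n \<Longrightarrow> sized n M"
  by (auto simp: CM_modules_def sized_def)

lemma sized_xm: "sized n M \<Longrightarrow> i \<in> {1..n} \<Longrightarrow> xm M i \<in> carrier_mat (rk M i) (rk M (vpred n i))"
  and sized_ym: "sized n M \<Longrightarrow> i \<in> {1..n} \<Longrightarrow> ym M i \<in> carrier_mat (rk M (vpred n i)) (rk M i)"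
  by (auto simp: sized_def)

lemma qrep_homI:
  assumes "\<And>i. i \<in> {1..n} \<Longrightarrow> \<phi> i \<in> carrier_mat (rk N i) (rk M i)"
    "\<And>i. i \<notin> {1..n} \<Longrightarrow> \<phi> i = undefined"
    "\<And>i. i \<in> {1..n} \<Longrightarrow> \<phi> i * xm M i = xm N i * \<phi> (vpred n i)"
    "\<And>i. i \<in> {1..n} \<Longrightarrow> \<phi> (vpred n i) * ym M i = ym N i * \<phi> i"
  shows "\<phi> \<in> carrier (qrep_hom n M N)"
  using assms by (auto simp: qrep_hom_def PiE_def extensional_def)

lemma qrep_homD:
  assumes "\<phi> \<in> carrier (qrep_hom n M N)"
  shows "i \<in> {1..n} \<Longrightarrow> \<phi> i \<in> carrier_mat (rk N i) (rk M i)"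
    "i \<notin> {1..n} \<Longrightarrow> \<phi> i = undefined"
    "i \<in> {1..n} \<Longrightarrow> \<phi> i * xm M i = xm N i * \<phi> (vpred n i)"
    "i \<in> {1..n} \<Longrightarrow> \<phi> (vpred n i) * ym M i = ym N i * \<phi> i"
  using assms by (auto simp: qrep_hom_def PiE_def extensional_def)

lemma qrep_hom_ext:
  assumes "\<phi> \<in> carrier (qrep_hom n M N)" "\<psi> \<in> carrier (qrep_hom n M' N')"
    "\<And>i. i \<in> {1..n} \<Longrightarrow> \<phi> i = \<psi> i"
  shows "\<phi> = \<psi>"
  using assms qrep_homD(2) by (metis ext)

abbreviation qcomp :: "nat \<Rightarrow> (nat \<Rightarrow> complex fps mat) \<Rightarrow> (nat \<Rightarrow> complex fps mat) \<Rightarrow> nat \<Rightarrow> complex fps mat" where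
  "qcomp n \<psi> \<phi> \<equiv> \<lambda>i\<in>{1..n}. \<psi> i * \<phi> i"

lemma qcomp_hom:
  assumes s: "sized n L" "sized n M" "sized n N"
    and phi: "\<phi> \<in> carrier (qrep_hom n L M)" and psi: "\<psi> \<in> carrier (qrep_hom n M N)"
  shows "qcomp n \<psi> \<phi> \<in> carrier (qrep_hom n L N)"
proof (rule qrep_homI)
  fix i assume i: "i \<in> {1..n}"
  note j = vpred_in[OF i]
  note c = qrep_homD(1)[OF phi i] qrep_homD(1)[OF phi j] qrep_homD(1)[OF psi i] qrep_homD(1)[OF psi j]
  note x = sized_xm[OF s(1) i] sized_xm[OF s(2) i] sized_xm[OF s(3) i]
  note y = sized_ym[OF s(1) i] sized_ym[OF s(2) i] sized_ym[OF s(3) i]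
  show "qcomp n \<psi> \<phi> i \<in> carrier_mat (rk N i) (rk L i)" using i c by auto
  have "\<psi> i * \<phi> i * xm L i = \<psi> i * (\<phi> i * xm L i)" by (rule assoc_mult_mat[OF c(3,1) x(1)])
  also have "\<dots> = \<psi> i * (xm M i * \<phi> (vpred n i))" by (simp add: qrep_homD(3)[OF phi i])
  also have "\<dots> = \<psi> i * xm M i * \<phi> (vpred n i)" by (rule assoc_mult_mat[OF c(3) x(2) c(2), symmetric])
  also have "\<dots> = xm N i * \<psi> (vpred n i) * \<phi> (vpred n i)" by (simp add: qrep_homD(3)[OF psi i])
  also have "\<dots> = xm N i * (\<psi> (vpred n i) * \<phi> (vpred n i))" by (rule assoc_mult_mat[OF x(3) c(4,2)])
  finally show "qcomp n \<psi> \<phi> i * xm L i = xm N i * qcomp n \<psi> \<phi> (vpred n i)" using i j by simp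
  have "\<psi> (vpred n i) * \<phi> (vpred n i) * ym L i = \<psi> (vpred n i) * (\<phi> (vpred n i) * ym L i)"
    by (rule assoc_mult_mat[OF c(4,2) y(1)])
  also have "\<dots> = \<psi> (vpred n i) * (ym M i * \<phi> i)" by (simp add: qrep_homD(4)[OF phi i])
  also have "\<dots> = \<psi> (vpred n i) * ym M i * \<phi> i" by (rule assoc_mult_mat[OF c(4) y(2) c(1), symmetric])
  also have "\<dots> = ym N i * \<psi> i * \<phi> i" by (simp add: qrep_homD(4)[OF psi i])
  also have "\<dots> = ym N i * (\<psi> i * \<phi> i)" by (rule assoc_mult_mat[OF y(3) c(3,1)])
  finally show "qcomp n \<psi> \<phi> (vpred n i) * ym L i = ym N i * qcomp n \<psi> \<phi> i" using i j by simp
qed auto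

lemma qcomp_assoc:
  assumes "\<phi> \<in> carrier (qrep_hom n K L)" "\<psi> \<in> carrier (qrep_hom n L M)" "\<chi> \<in> carrier (qrep_hom n M N)"
  shows "qcomp n \<chi> (qcomp n \<psi> \<phi>) = qcomp n (qcomp n \<chi> \<psi>) \<phi>"
proof (rule restrict_ext)
  fix i assume i: "i \<in> {1..n}"
  show "\<chi> i * qcomp n \<psi> \<phi> i = qcomp n \<chi> \<psi> i * \<phi> i"
    using assoc_mult_mat[OF qrep_homD(1)[OF assms(3) i] qrep_homD(1)[OF assms(2) i] qrep_homD(1)[OF assms(1) i]] i
    by simp
qed

lemma qrep_hom_add: "\<phi> \<oplus>\<^bsub>qrep_hom n M N\<^esub> \<psi> = (\<lambda>i\<in>{1..n}. \<phi> i + \<psi> i)"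
  and qrep_hom_smult: "c \<odot>\<^bsub>qrep_hom n M N\<^esub> \<phi> = (\<lambda>i\<in>{1..n}. fps_const c \<cdot>\<^sub>m \<phi> i)"
  and qrep_hom_zero: "\<zero>\<^bsub>qrep_hom n M N\<^esub> = (\<lambda>i\<in>{1..n}. 0\<^sub>m (rk N i) (rk M i))"
  by (simp_all add: qrep_hom_def)

lemma qrep_hom_zero_closed:
  assumes s: "sized n M" "sized n N"
  shows "\<zero>\<^bsub>qrep_hom n M N\<^esub> \<in> carrier (qrep_hom n M N)"
  by (rule qrep_homI)
    (use s in \<open>auto simp: qrep_hom_zero sized_def vpred_in[simplified]
      intro: left_mult_zero_mat right_mult_zero_mat left_mult_zero_mat[symmetric] right_mult_zero_mat[symmetric]
      trans[OF left_mult_zero_mat right_mult_zero_mat[symmetric]]\<close>)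

lemma qrep_hom_add_closed:
  assumes s: "sized n M" "sized n N"
    and phi: "\<phi> \<in> carrier (qrep_hom n M N)" and psi: "\<psi> \<in> carrier (qrep_hom n M N)"
  shows "\<phi> \<oplus>\<^bsub>qrep_hom n M N\<^esub> \<psi> \<in> carrier (qrep_hom n M N)"
  unfolding qrep_hom_add
proof (rule qrep_homI)
  fix i assume i: "i \<in> {1..n}"
  note j = vpred_in[OF i]
  note c = qrep_homD(1)[OF phi i] qrep_homD(1)[OF phi j] qrep_homD(1)[OF psi i] qrep_homD(1)[OF psi j]
  note xy = sized_xm[OF s(1) i] sized_xm[OF s(2) i] sized_ym[OF s(1) i] sized_ym[OF s(2) i]
  show "(\<lambda>i\<in>{1..n}. \<phi> i + \<psi> i) i \<in> carrier_mat (rk N i) (rk M i)" using i c by auto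
  show "(\<lambda>i\<in>{1..n}. \<phi> i + \<psi> i) i * xm M i = xm N i * (\<lambda>i\<in>{1..n}. \<phi> i + \<psi> i) (vpred n i)"
    using i j add_mult_distrib_mat[OF c(1,3) xy(1)] mult_add_distrib_mat[OF xy(2) c(2,4)]
    by (simp add: qrep_homD(3)[OF phi i] qrep_homD(3)[OF psi i])
  show "(\<lambda>i\<in>{1..n}. \<phi> i + \<psi> i) (vpred n i) * ym M i = ym N i * (\<lambda>i\<in>{1..n}. \<phi> i + \<psi> i) i"
    using i j add_mult_distrib_mat[OF c(2,4) xy(3)] mult_add_distrib_mat[OF xy(4) c(1,3)]
    by (simp add: qrep_homD(4)[OF phi i] qrep_homD(4)[OF psi i])
qed auto

lemma qrep_hom_smult_closed:
  assumes s: "sized n M" "sized n N"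
    and phi: "\<phi> \<in> carrier (qrep_hom n M N)"
  shows "c \<odot>\<^bsub>qrep_hom n M N\<^esub> \<phi> \<in> carrier (qrep_hom n M N)"
  unfolding qrep_hom_smult
proof (rule qrep_homI)
  fix i assume i: "i \<in> {1..n}"
  note j = vpred_in[OF i]
  note c = qrep_homD(1)[OF phi i] qrep_homD(1)[OF phi j]
  note xy = sized_xm[OF s(1) i] sized_xm[OF s(2) i] sized_ym[OF s(1) i] sized_ym[OF s(2) i]
  show "(\<lambda>i\<in>{1..n}. fps_const c \<cdot>\<^sub>m \<phi> i) i \<in> carrier_mat (rk N i) (rk M i)" using i c by auto
  show "(\<lambda>i\<in>{1..n}. fps_const c \<cdot>\<^sub>m \<phi> i) i * xm M i = xm N i * (\<lambda>i\<in>{1..n}. fps_const c \<cdot>\<^sub>m \<phi> i) (vpred n i)"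
    using i j mult_smult_assoc_mat[OF c(1) xy(1)] mult_smult_distrib[OF xy(2) c(2)]
    by (simp add: qrep_homD(3)[OF phi i])
  show "(\<lambda>i\<in>{1..n}. fps_const c \<cdot>\<^sub>m \<phi> i) (vpred n i) * ym M i = ym N i * (\<lambda>i\<in>{1..n}. fps_const c \<cdot>\<^sub>m \<phi> i) i"
    using i j mult_smult_assoc_mat[OF c(2) xy(3)] mult_smult_distrib[OF xy(4) c(1)]
    by (simp add: qrep_homD(4)[OF phi i])
qed auto

lemma qrep_hom_vectorspace:
  assumes s: "sized n M" "sized n N"
  shows "vectorspace class_ring (qrep_hom n M N)"
proof -
  let ?H = "qrep_hom n M N"
  have D: "\<phi> i \<in> carrier_mat (rk N i) (rk M i)" if "\<phi> \<in> carrier ?H" "i \<in> {1..n}" for \<phi> i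
    using qrep_homD(1) that by blast
  have restr: "(\<lambda>i\<in>{1..n}. \<phi> i) = \<phi>" if "\<phi> \<in> carrier ?H" for \<phi>
    using qrep_homD(2)[OF that] by (intro ext) auto
  have "abelian_group ?H"
  proof (rule abelian_groupI)
    fix \<phi> \<psi> \<chi> assume h: "\<phi> \<in> carrier ?H" "\<psi> \<in> carrier ?H" "\<chi> \<in> carrier ?H"
    show "\<phi> \<oplus>\<^bsub>?H\<^esub> \<psi> \<oplus>\<^bsub>?H\<^esub> \<chi> = \<phi> \<oplus>\<^bsub>?H\<^esub> (\<psi> \<oplus>\<^bsub>?H\<^esub> \<chi>)"
      unfolding qrep_hom_add
      by (rule restrict_ext) (simp add: assoc_add_mat[OF D[OF h(1)] D[OF h(2)] D[OF h(3)]])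
  next
    fix \<phi> \<psi> assume h: "\<phi> \<in> carrier ?H" "\<psi> \<in> carrier ?H"
    show "\<phi> \<oplus>\<^bsub>?H\<^esub> \<psi> = \<psi> \<oplus>\<^bsub>?H\<^esub> \<phi>"
      unfolding qrep_hom_add by (rule restrict_ext) (rule comm_add_mat[OF D[OF h(1)] D[OF h(2)]])
  next
    fix \<phi> assume h: "\<phi> \<in> carrier ?H"
    have "\<zero>\<^bsub>?H\<^esub> \<oplus>\<^bsub>?H\<^esub> \<phi> = (\<lambda>i\<in>{1..n}. \<phi> i)"
      unfolding qrep_hom_add qrep_hom_zero by (rule restrict_ext) (simp add: left_add_zero_mat[OF D[OF h]])
    then show "\<zero>\<^bsub>?H\<^esub> \<oplus>\<^bsub>?H\<^esub> \<phi> = \<phi>" using restr[OF h] by simp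
    have "((-1) \<odot>\<^bsub>?H\<^esub> \<phi>) \<oplus>\<^bsub>?H\<^esub> \<phi> = \<zero>\<^bsub>?H\<^esub>"
      unfolding qrep_hom_add qrep_hom_zero qrep_hom_smult
    proof (rule restrict_ext)
      fix i assume i: "i \<in> {1..n}"
      have "fps_const (-1) \<cdot>\<^sub>m A + A = 0\<^sub>m r c" if "A \<in> carrier_mat r c" for A :: "complex fps mat" and r c
        using that by (intro eq_matI) (auto simp flip: fps_const_neg)
      from this[OF D[OF h i]] show "(\<lambda>i\<in>{1..n}. fps_const (-1) \<cdot>\<^sub>m \<phi> i) i + \<phi> i = 0\<^sub>m (rk N i) (rk M i)"
        using i by simp
    qed
    then show "\<exists>\<psi>\<in>carrier ?H. \<psi> \<oplus>\<^bsub>?H\<^esub> \<phi> = \<zero>\<^bsub>?H\<^esub>" using qrep_hom_smult_closed[OF s h] by blast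
  qed (auto simp: s qrep_hom_add_closed qrep_hom_zero_closed)
  moreover have "Module.module_axioms class_ring ?H"
  proof (rule Module.module_axioms.intro)
    fix a :: complex and \<phi> assume "\<phi> \<in> carrier ?H"
    then show "a \<odot>\<^bsub>?H\<^esub> \<phi> \<in> carrier ?H" by (rule qrep_hom_smult_closed[OF s])
  next
    fix a b :: complex and \<phi> assume h: "\<phi> \<in> carrier ?H"
    show "(a \<oplus>\<^bsub>class_ring\<^esub> b) \<odot>\<^bsub>?H\<^esub> \<phi> = a \<odot>\<^bsub>?H\<^esub> \<phi> \<oplus>\<^bsub>?H\<^esub> b \<odot>\<^bsub>?H\<^esub> \<phi>"
      unfolding qrep_hom_add qrep_hom_smult
      by (intro restrict_ext) (simp add: add_smult_distrib_right_mat[OF D[OF h]] flip: fps_const_add)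
    show "(a \<otimes>\<^bsub>class_ring\<^esub> b) \<odot>\<^bsub>?H\<^esub> \<phi> = a \<odot>\<^bsub>?H\<^esub> (b \<odot>\<^bsub>?H\<^esub> \<phi>)"
      unfolding qrep_hom_smult
      by (intro restrict_ext) (auto simp: mult.assoc simp flip: fps_const_mult intro!: eq_matI)
  next
    fix a :: complex and \<phi> \<psi> assume h: "\<phi> \<in> carrier ?H" "\<psi> \<in> carrier ?H"
    show "a \<odot>\<^bsub>?H\<^esub> (\<phi> \<oplus>\<^bsub>?H\<^esub> \<psi>) = a \<odot>\<^bsub>?H\<^esub> \<phi> \<oplus>\<^bsub>?H\<^esub> a \<odot>\<^bsub>?H\<^esub> \<psi>"
      unfolding qrep_hom_add qrep_hom_smult
      by (intro restrict_ext) (simp add: add_smult_distrib_left_mat[OF D[OF h(1)] D[OF h(2)]])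
  next
    fix \<phi> assume h: "\<phi> \<in> carrier ?H"
    have "\<one>\<^bsub>class_ring\<^esub> \<odot>\<^bsub>?H\<^esub> \<phi> = (\<lambda>i\<in>{1..n}. \<phi> i)"
      unfolding qrep_hom_smult using D[OF h] by (intro restrict_ext) (auto intro!: eq_matI)
    then show "\<one>\<^bsub>class_ring\<^esub> \<odot>\<^bsub>?H\<^esub> \<phi> = \<phi>" using restr[OF h] by simp
  qed
  ultimately show ?thesis
    by (intro vectorspace.intro Module.module.intro class_field class_cring.is_cring)
qed

section \<open>Direct sums of rank one modules\<close>

abbreviation ds :: "nat set list \<Rightarrow> qrep" where
  "ds Is \<equiv> dsum (map rank_one Is)"

lemma diag_block_mat_scalars:
  "diag_block_mat (map (\<lambda>I. f I \<cdot>\<^sub>m 1\<^sub>m 1) Is) = mat_diag (length Is) (\<lambda>p. f (Is ! p) :: 'a :: comm_ring_1)"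
proof (induction Is)
  case (Cons I Is)
  show ?case
    unfolding list.map diag_block_mat.simps Let_def Cons.IH mat_diag_def
    by (rule eq_matI) (auto simp: nth_Cons' mat_diag_def)
qed (auto simp: mat_diag_def)

lemma rk_ds [simp]: "rk (ds Is) i = length Is"
  by (induction Is) (auto simp: dsum_def rank_one_def)

lemma xm_ds: "xm (ds Is) i = mat_diag (length Is) (\<lambda>p. if i \<in> Is ! p then 1 else fps_X)"
  and ym_ds: "ym (ds Is) i = mat_diag (length Is) (\<lambda>p. if i \<in> Is ! p then fps_X else 1)"
  using diag_block_mat_scalars[of "\<lambda>I. if i \<in> I then 1 else fps_X" Is]
    diag_block_mat_scalars[of "\<lambda>I. if i \<in> I then fps_X else 1" Is]
  by (simp_all add: dsum_def rank_one_def comp_def)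

lemma sized_ds [simp]: "sized n (ds Is)"
  by (auto simp: sized_def xm_ds ym_ds)

text \<open>All arrows act by diagonal matrices, so the commutation conditions decouple into scalar
  equations, one for each matrix entry and arrow.\<close>

lemma qrep_hom_dsI:
  assumes "\<And>i. i \<in> {1..n} \<Longrightarrow> \<phi> i \<in> carrier_mat (length Js) (length Is)"
    "\<And>i. i \<notin> {1..n} \<Longrightarrow> \<phi> i = undefined"
    "\<And>i p q. i \<in> {1..n} \<Longrightarrow> p < length Js \<Longrightarrow> q < length Is \<Longrightarrow>
       \<phi> i $$ (p, q) * (if i \<in> Is ! q then 1 else fps_X) =
         (if i \<in> Js ! p then 1 else fps_X) * \<phi> (vpred n i) $$ (p, q)"
    "\<And>i p q. i \<in> {1..n} \<Longrightarrow> p < length Js \<Longrightarrow> q < length Is \<Longrightarrow>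
       \<phi> (vpred n i) $$ (p, q) * (if i \<in> Is ! q then fps_X else 1) =
         (if i \<in> Js ! p then fps_X else 1) * \<phi> i $$ (p, q)"
  shows "\<phi> \<in> carrier (qrep_hom n (ds Is) (ds Js))"
proof (rule qrep_homI)
  fix i assume i: "i \<in> {1..n}"
  note c = assms(1)[OF i] assms(1)[OF vpred_in[OF i]]
  show "\<phi> i * xm (ds Is) i = xm (ds Js) i * \<phi> (vpred n i)"
    unfolding xm_ds mat_diag_mult_right[OF c(1)] mat_diag_mult_left[OF c(2)]
    by (rule cong_mat) (use assms(3)[OF i] in auto)
  show "\<phi> (vpred n i) * ym (ds Is) i = ym (ds Js) i * \<phi> i"
    unfolding ym_ds mat_diag_mult_right[OF c(2)] mat_diag_mult_left[OF c(1)]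
    by (rule cong_mat) (use assms(4)[OF i] in auto)
qed (use assms in auto)

lemma qrep_hom_ds_entry:
  assumes phi: "\<phi> \<in> carrier (qrep_hom n (ds Is) (ds Js))" and i: "i \<in> {1..n}"
    and pq: "p < length Js" "q < length Is"
  shows "\<phi> i $$ (p, q) * (if i \<in> Is ! q then 1 else fps_X) =
         (if i \<in> Js ! p then 1 else fps_X) * \<phi> (vpred n i) $$ (p, q)"
proof -
  have c: "\<phi> i \<in> carrier_mat (length Js) (length Is)" "\<phi> (vpred n i) \<in> carrier_mat (length Js) (length Is)"
    using qrep_homD(1)[OF phi] i vpred_in[OF i] by auto
  have "(\<phi> i * xm (ds Is) i) $$ (p, q) = (xm (ds Js) i * \<phi> (vpred n i)) $$ (p, q)"
    using qrep_homD(3)[OF phi i] by simp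
  then show ?thesis
    unfolding xm_ds mat_diag_mult_right[OF c(1)] mat_diag_mult_left[OF c(2)] using pq by simp
qed

text \<open>The path \<open>x^i\<close> from vertex \<open>n\<close> to vertex \<open>i\<close> acts
  on the module with label \<open>I\<close> by \<open>fps_X ^ (i - cnt I i)\<close>. Differences of
  counts therefore give the power of \<open>fps_X\<close> that an entry of a homomorphism picks up
  between \<open>n\<close> and \<open>i\<close>.\<close>

definition cnt :: "nat set \<Rightarrow> nat \<Rightarrow> nat" where
  "cnt I i = card (I \<inter> {1..i})"

lemma cnt_0 [simp]: "cnt I 0 = 0"
  by (simp add: cnt_def)

lemma cnt_Suc: "cnt I (Suc i) = cnt I i + (if Suc i \<in> I then 1 else 0)"
proof -
  have "I \<inter> {1..Suc i} = (if Suc i \<in> I then insert (Suc i) (I \<inter> {1..i}) else I \<inter> {1..i})"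
    by (auto simp: le_Suc_eq)
  then show ?thesis by (simp add: cnt_def)
qed

text \<open>
  Composing with the embeddings of \<open>L\<^sub>I\<close> and \<open>L\<^sub>J\<close> into the constant representation over Laurent
  series turns a homomorphism into a constant.
\<close>

lemma qrep_hom_ds_cnt:
  assumes phi: "\<phi> \<in> carrier (qrep_hom n (ds Is) (ds Js))"
    and pq: "p < length Js" "q < length Is"
  shows "i \<in> {1..n} \<Longrightarrow> \<phi> i $$ (p, q) * fps_X ^ cnt (Js ! p) i = fps_X ^ cnt (Is ! q) i * \<phi> n $$ (p, q)"
proof (induction i)
  case (Suc i)
  \<comment> \<open>The predecessor of vertex 1 is \<open>n\<close>, so the induction starts from
    the entry at \<open>n\<close>, where both counts are zero.\<close>
  define f where "f = (if i = 0 then \<phi> n $$ (p, q) else \<phi> i $$ (p, q))"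
  have f: "f * fps_X ^ cnt (Js ! p) i = fps_X ^ cnt (Is ! q) i * \<phi> n $$ (p, q)"
    using Suc by (auto simp: f_def)
  let ?g = "\<phi> (Suc i) $$ (p, q)"
  have "?g * (if Suc i \<in> Is ! q then 1 else fps_X) = (if Suc i \<in> Js ! p then 1 else fps_X) * f"
    using qrep_hom_ds_entry[OF phi Suc.prems pq] by (simp add: vpred_def f_def)
  \<comment> \<open>This cancellation settles the case in which \<open>Suc i\<close> lies in
    \<open>Is ! q\<close> or in \<open>Js ! p\<close> in such a way that both sides carry a factor
    \<open>fps_X\<close>.\<close>
  moreover have "?g * fps_X = f * fps_X \<Longrightarrow> ?g = f" by simp
  ultimately show ?case
    using f by (auto simp: cnt_Suc mult_ac split: if_splits)
qed simp

text \<open>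
  The subtraction in the exponent is only meaningful if it does not truncate, which is the first
  hypothesis of \<open>mono_hom_hom\<close>.
\<close>

definition mono_hom :: "nat \<Rightarrow> nat set list \<Rightarrow> nat set list \<Rightarrow> (nat \<Rightarrow> nat \<Rightarrow> nat) \<Rightarrow> complex fps mat
    \<Rightarrow> nat \<Rightarrow> complex fps mat" where
  "mono_hom n Is Js s C = (\<lambda>i\<in>{1..n}. mat (length Js) (length Is)
     (\<lambda>(p, q). fps_X ^ (s p q + cnt (Is ! q) i - cnt (Js ! p) i) * C $$ (p, q)))"

text \<open>Equal total counts make the exponent at vertex \<open>n\<close> agree with the exponent
  formula at \<open>i = 0\<close>, so the arrows between \<open>n\<close> and 1 obey the same
  computation as all others. This is also why the inequality is assumed from \<open>i = 0\<close>
  on.\<close>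

lemma mono_hom_hom:
  assumes le: "\<And>i p q. i \<le> n \<Longrightarrow> p < length Js \<Longrightarrow> q < length Is \<Longrightarrow> cnt (Js ! p) i \<le> s p q + cnt (Is ! q) i"
    and eq: "\<And>p q. p < length Js \<Longrightarrow> q < length Is \<Longrightarrow> cnt (Js ! p) n = cnt (Is ! q) n"
  shows "mono_hom n Is Js s C \<in> carrier (qrep_hom n (ds Is) (ds Js))"
proof -
  have *: "mono_hom n Is Js s C (vpred n i) $$ (p, q)
    = fps_X ^ (s p q + cnt (Is ! q) (i - 1) - cnt (Js ! p) (i - 1)) * C $$ (p, q)"
    if "i \<in> {1..n}" "p < length Js" "q < length Is" for i p q
    using that eq[OF that(2,3)] by (auto simp: mono_hom_def vpred_def)
  have **: "mono_hom n Is Js s C i $$ (p, q)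
    = fps_X ^ (s p q + cnt (Is ! q) i - cnt (Js ! p) i) * C $$ (p, q)"
    if "i \<in> {1..n}" "p < length Js" "q < length Is" for i p q
    using that by (auto simp: mono_hom_def)
  have c: "cnt I i = cnt I (i - 1) + (if i \<in> I then 1 else 0)" if "i \<in> {1..n}" for I i
    using that by (cases i) (auto simp: cnt_Suc)
  have X: "fps_X * fps_X ^ (a - Suc b) = (fps_X :: complex fps) ^ (a - b)" if "Suc b \<le> a" for a b
    using that by (metis Suc_diff_Suc Suc_le_lessD power_Suc)
  show ?thesis
  proof (rule qrep_hom_dsI)
    fix i p q assume i: "i \<in> {1..n}" and pq: "p < length Js" "q < length Is"
    note le = le[of i p q, OF _ pq] le[of "i - 1" p q, OF _ pq]
    show "mono_hom n Is Js s C i $$ (p, q) * (if i \<in> Is ! q then 1 else fps_X) =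
         (if i \<in> Js ! p then 1 else fps_X) * mono_hom n Is Js s C (vpred n i) $$ (p, q)"
      unfolding *[OF i pq] **[OF i pq] using le i
      by (auto simp: c[OF i] mult_ac X Suc_diff_le)
    show "mono_hom n Is Js s C (vpred n i) $$ (p, q) * (if i \<in> Is ! q then fps_X else 1) =
         (if i \<in> Js ! p then fps_X else 1) * mono_hom n Is Js s C i $$ (p, q)"
      unfolding *[OF i pq] **[OF i pq] using le i
      by (auto simp: c[OF i] mult_ac X Suc_diff_le)
  qed (auto simp: mono_hom_def)
qed

section \<open>The projective at the vertex \<open>n\<close>\<close>

text \<open>The exponents of the action of the paths \<open>x^m\<close> and \<open>y^m\<close> from vertex \<open>i\<close> on \<open>L\<^sub>I\<close>.\<close>

primrec xexp :: "nat \<Rightarrow> nat set \<Rightarrow> nat \<Rightarrow> nat \<Rightarrow> nat" where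
  "xexp n I 0 i = 0"
| "xexp n I (Suc m) i = xexp n I m (vsucc n i) + (if vsucc n i \<in> I then 0 else 1)"

primrec yexp :: "nat \<Rightarrow> nat set \<Rightarrow> nat \<Rightarrow> nat \<Rightarrow> nat" where
  "yexp n I 0 i = 0"
| "yexp n I (Suc m) i = yexp n I m (vpred n i) + (if i \<in> I then 1 else 0)"

lemma xpath_ds: "xpath n (ds Is) m i = mat_diag (length Is) (\<lambda>p. fps_X ^ xexp n (Is ! p) m i)"
  and ypath_ds: "ypath n (ds Is) m i = mat_diag (length Is) (\<lambda>p. fps_X ^ yexp n (Is ! p) m i)"
  by (induction m arbitrary: i) (auto simp: xm_ds ym_ds mult_ac intro!: arg_cong[of _ _ "mat_diag _"])

text \<open>For any label the product of the two arrows is \<open>fps_X\<close> in either order, so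
  only the relation between \<open>x^k\<close> and \<open>y^(n-k)\<close> depends on the labels, and
  it becomes an equality of exponents.\<close>

lemma ds_CM:
  assumes "\<And>I i. I \<in> set Is \<Longrightarrow> i \<in> {1..n} \<Longrightarrow> xexp n I k i = yexp n I (n - k) i"
  shows "ds Is \<in> CM_modules k n"
proof -
  have "mat_diag (length Is) (\<lambda>p. fps_X ^ xexp n (Is ! p) k i) =
      (mat_diag (length Is) (\<lambda>p. fps_X ^ yexp n (Is ! p) (n - k) i) :: complex fps mat)"
    if "i \<in> {1..n}" for i
    using assms that by (auto simp: mat_diag_def intro!: eq_matI)
  moreover have "mat_diag r (\<lambda>p. fps_X) = fps_X \<cdot>\<^sub>m (1\<^sub>m r :: complex fps mat)" for r
    by (auto simp: mat_diag_def intro!: eq_matI)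
  moreover have "(if b then 1 else fps_X) * (if b then fps_X else 1) = (fps_X :: complex fps)"
    "(if b then fps_X else 1) * (if b then 1 else fps_X) = (fps_X :: complex fps)" for b by auto
  ultimately show ?thesis
    unfolding CM_modules_def mem_Collect_eq xpath_ds ypath_ds
    by (simp add: xm_ds ym_ds)
qed

lemma CM_xy: "M \<in> CM_modules k n \<Longrightarrow> i \<in> {1..n} \<Longrightarrow> xm M i * ym M i = fps_X \<cdot>\<^sub>m 1\<^sub>m (rk M i)"
  unfolding CM_modules_def by blast

lemma CM_xpath_ypath: "M \<in> CM_modules k n \<Longrightarrow> i \<in> {1..n} \<Longrightarrow> xpath n M k i = ypath n M (n - k) i"
  by (auto simp: CM_modules_def)

text \<open>\<open>CM_modules\<close> fixes the action of \<open>t\<close> through \<open>xy\<close>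
  at each vertex; the relation \<open>xy = yx\<close> at the preceding vertex transfers it to the
  other order.\<close>

lemma CM_yx:
  assumes M: "M \<in> CM_modules k n" and i: "i \<in> {1..n}"
  shows "ym M i * xm M i = fps_X \<cdot>\<^sub>m 1\<^sub>m (rk M (vpred n i))"
proof -
  have j: "vpred n i \<in> {1..n}" by (rule vpred_in[OF i])
  have "vsucc n (vpred n i) = i" using i by (auto simp: vsucc_def vpred_def)
  moreover have "xm M (vpred n i) * ym M (vpred n i) =
      ym M (vsucc n (vpred n i)) * xm M (vsucc n (vpred n i))"
    using M j unfolding CM_modules_def by blast
  ultimately show ?thesis using CM_xy[OF M j] by simp
qed

lemma xpath_carrier:
  assumes "sized n M"
  shows "i \<in> {1..n} \<Longrightarrow> xpath n M m i \<in> carrier_mat (rk M ((vsucc n ^^ m) i)) (rk M i)"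
proof (induction m arbitrary: i)
  case (Suc m)
  have "vpred n (vsucc n i) = i" using Suc.prems by (auto simp: vsucc_def vpred_def)
  then show ?case
    using Suc.IH[OF vsucc_in[OF Suc.prems]] sized_xm[OF assms vsucc_in[OF Suc.prems]]
    by (simp add: funpow_swap1)
qed simp

lemma ypath_carrier:
  assumes "sized n M"
  shows "i \<in> {1..n} \<Longrightarrow> ypath n M m i \<in> carrier_mat (rk M ((vpred n ^^ m) i)) (rk M i)"
proof (induction m arbitrary: i)
  case (Suc m)
  then show ?case
    using Suc.IH[OF vpred_in[OF Suc.prems]] sized_ym[OF assms Suc.prems]
    by (simp add: funpow_swap1)
qed simp

lemma funpow_in: "(\<And>i. i \<in> S \<Longrightarrow> f i \<in> S) \<Longrightarrow> i \<in> S \<Longrightarrow> (f ^^ m) i \<in> S"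
  by (induction m) auto

text \<open>The recursion for \<open>xpath\<close> splits off the first arrow. Extending a
  homomorphism vertex by vertex requires splitting off the last one, and associativity moves between
  the two; \<open>ypath_Suc_last\<close> is the mirror image.\<close>

lemma xpath_Suc_last:
  assumes s: "sized n M"
  shows "i \<in> {1..n} \<Longrightarrow> xpath n M (Suc m) i = xm M ((vsucc n ^^ Suc m) i) * xpath n M m i"
proof (induction m arbitrary: i)
  case 0
  have "vpred n (vsucc n i) = i" using 0 by (auto simp: vsucc_def vpred_def)
  then show ?case using sized_xm[OF s vsucc_in[OF 0]] by simp
next
  case (Suc m)
  note j = vsucc_in[OF Suc.prems]
  have j': "vpred n (vsucc n i) = i" using Suc.prems by (auto simp: vsucc_def vpred_def)
  have k: "(vsucc n ^^ m) (vsucc n i) \<in> {1..n}" for m by (rule funpow_in[OF vsucc_in j])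
  have k': "vpred n ((vsucc n ^^ Suc m) (vsucc n i)) = (vsucc n ^^ m) (vsucc n i)"
    using k[of m] by (auto simp: vsucc_def vpred_def)
  have "xpath n M (Suc (Suc m)) i = xpath n M (Suc m) (vsucc n i) * xm M (vsucc n i)"
    by (simp only: xpath.simps)
  also have "\<dots> = xm M ((vsucc n ^^ Suc m) (vsucc n i)) * xpath n M m (vsucc n i) * xm M (vsucc n i)"
    by (simp only: Suc.IH[OF j])
  also have "\<dots> = xm M ((vsucc n ^^ Suc m) (vsucc n i)) * (xpath n M m (vsucc n i) * xm M (vsucc n i))"
    by (rule assoc_mult_mat[OF sized_xm[OF s k[of "Suc m"], unfolded k'] xpath_carrier[OF s j] sized_xm[OF s j]])
  finally show ?case by (simp add: funpow_swap1)
qed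

lemma ypath_Suc_last:
  assumes s: "sized n M"
  shows "i \<in> {1..n} \<Longrightarrow> ypath n M (Suc m) i = ym M ((vpred n ^^ m) i) * ypath n M m i"
proof (induction m arbitrary: i)
  case 0
  then show ?case using sized_ym[OF s 0] by simp
next
  case (Suc m)
  note j = vpred_in[OF Suc.prems]
  have k: "(vpred n ^^ m) (vpred n i) \<in> {1..n}" by (rule funpow_in[OF vpred_in j])
  have "ypath n M (Suc (Suc m)) i = ypath n M (Suc m) (vpred n i) * ym M i"
    by (simp only: ypath.simps)
  also have "\<dots> = ym M ((vpred n ^^ m) (vpred n i)) * ypath n M m (vpred n i) * ym M i"
    by (simp only: Suc.IH[OF j])
  also have "\<dots> = ym M ((vpred n ^^ m) (vpred n i)) * (ypath n M m (vpred n i) * ym M i)"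
    by (rule assoc_mult_mat[OF sized_ym[OF s k] ypath_carrier[OF s j] sized_ym[OF s Suc.prems]])
  finally show ?case by (simp add: funpow_swap1)
qed

text \<open>Vertex 0 is named \<open>n\<close>, hence the exclusion of \<open>m = 0\<close>.\<close>

lemma vsucc_funpow: "m \<le> n \<Longrightarrow> 0 < m \<Longrightarrow> (vsucc n ^^ m) n = m"
proof (induction m)
  case (Suc m)
  then show ?case by (cases "m = 0") (auto simp: vsucc_def)
qed simp

lemma vpred_funpow: "m < n \<Longrightarrow> (vpred n ^^ m) n = n - m"
  by (induction m) (auto simp: vpred_def)

lemma rk_replicate [simp]: "rk (dsum (replicate r (rank_one I))) i = r"
  using rk_ds[of "replicate r I" i] by simp

section \<open>Freeness and projectivity of the modules with label \<open>{1..k}\<close>\<close>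

locale proj_n =
  fixes k n :: nat
  assumes k: "0 < k" "k < n"
begin

abbreviation proj :: "nat \<Rightarrow> qrep" where
  "proj r \<equiv> ds (replicate r {1..k})"

lemma n_in: "n \<in> {1..n}" using k by auto

lemma xm_proj: "xm (proj r) i = mat_diag r (\<lambda>p. if i \<in> {1..k} then 1 else fps_X)"
  and ym_proj: "ym (proj r) i = mat_diag r (\<lambda>p. if i \<in> {1..k} then fps_X else 1)"
  unfolding xm_ds ym_ds mat_diag_def by (auto intro!: cong_mat)

lemma xy_proj:
  "i \<in> {1..k} \<Longrightarrow> xm (proj r) i = 1\<^sub>m r" "i \<in> {1..k} \<Longrightarrow> ym (proj r) i = fps_X \<cdot>\<^sub>m 1\<^sub>m r"
  "i \<notin> {1..k} \<Longrightarrow> xm (proj r) i = fps_X \<cdot>\<^sub>m 1\<^sub>m r" "i \<notin> {1..k} \<Longrightarrow> ym (proj r) i = 1\<^sub>m r"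
  unfolding xm_proj ym_proj by (auto simp: mat_diag_def intro!: eq_matI)

text \<open>
  The module \<open>proj r\<close> is free on \<open>r\<close> generators at the vertex \<open>n\<close>: the paths \<open>x^i\<close> and \<open>y^(n - i)\<close>
  from \<open>n\<close> to \<open>i\<close> act by the identity for \<open>i \<le> k\<close> and for \<open>i \<ge> k\<close>.
\<close>

lemma proj_hom_eqI:
  assumes phi: "\<phi> \<in> carrier (qrep_hom n (proj r) N)" and psi: "\<psi> \<in> carrier (qrep_hom n (proj r) N)"
    and eq: "\<phi> n = \<psi> n"
  shows "\<phi> = \<psi>"
proof (rule qrep_hom_ext[OF phi psi])
  fix i assume i: "i \<in> {1..n}"
  note c = qrep_homD(1)[OF phi, unfolded rk_ds length_replicate] qrep_homD(1)[OF psi, unfolded rk_ds length_replicate]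
  have up: "i \<in> {1..k} \<Longrightarrow> \<phi> i = \<psi> i" for i
  proof (induction i)
    case (Suc i)
    then have S: "Suc i \<in> {1..n}" using k by auto
    have "\<phi> (vpred n (Suc i)) = \<psi> (vpred n (Suc i))"
      using Suc eq by (auto simp: vpred_def)
    then have "\<phi> (Suc i) * 1\<^sub>m r = \<psi> (Suc i) * 1\<^sub>m r"
      using qrep_homD(3)[OF phi S] qrep_homD(3)[OF psi S] xy_proj(1)[OF Suc.prems] by simp
    then show ?case using c[OF S] by simp
  qed simp
  have down: "k < i \<Longrightarrow> i \<le> n \<Longrightarrow> \<phi> i = \<psi> i" for i
  proof (induction "n - i" arbitrary: i)
    case 0
    then show ?case using eq by simp
  next
    case (Suc m)
    then have S: "Suc i \<in> {1..n}" "i \<in> {1..n}" "Suc i \<notin> {1..k}" "vpred n (Suc i) = i"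
      by (auto simp: vpred_def)
    have "\<phi> (Suc i) = \<psi> (Suc i)" using Suc by auto
    then have "\<phi> i * 1\<^sub>m r = \<psi> i * 1\<^sub>m r"
      using qrep_homD(4)[OF phi S(1)] qrep_homD(4)[OF psi S(1)] xy_proj(4)[OF S(3)] S(4) by simp
    then show ?case using c[OF S(2)] by simp
  qed
  show "\<phi> i = \<psi> i" using up[of i] down[of i] i by (cases "i \<le> k") auto
qed

text \<open>The generators at \<open>n\<close> may be sent anywhere: push \<open>W\<close> along the
  \<open>x\<close>-arrows up to vertex \<open>k\<close>, and along the \<open>y\<close>-arrows from
  \<open>n\<close> down to \<open>k\<close>. The two prescriptions meet at \<open>k\<close>, and
  along the opposite arrows the conditions reduce to \<open>xy = t = yx\<close>.\<close>

lemma proj_hom_exists: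
  assumes M: "M \<in> CM_modules k n" and W: "W \<in> carrier_mat (rk M n) r"
  shows "\<exists>\<psi>\<in>carrier (qrep_hom n (proj r) M). \<psi> n = W"
proof -
  note s = sized_if_CM[OF M]
  define u where "u m = xpath n M m n * W" for m
  define d where "d m = ypath n M m n * W" for m
  define \<psi> where "\<psi> i = (if i \<in> {1..n} then if i \<le> k then u i else d (n - i) else undefined)" for i
  have u0: "u 0 = W" and d0: "d 0 = W" using W by (auto simp: u_def d_def)
  have uc: "u i \<in> carrier_mat (rk M i) r" if "i \<in> {1..n}" for i
    using xpath_carrier[OF s n_in, of i] that W by (auto simp: u_def vsucc_funpow)
  have dc: "d (n - i) \<in> carrier_mat (rk M i) r" if "i \<in> {1..n}" for i
    using ypath_carrier[OF s n_in, of "n - i"] that W by (auto simp: d_def vpred_funpow)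
  have uS: "u i = xm M i * (if i = 1 then W else u (i - 1))" if i: "i \<in> {1..n}" for i
  proof -
    obtain m where m: "i = Suc m" using i by (cases i) auto
    have "vsucc n ((vsucc n ^^ m) n) = Suc m"
      using vsucc_funpow[of "Suc m" n] i m by simp
    then have "xpath n M i n = xm M i * xpath n M m n"
      using xpath_Suc_last[OF s n_in, of m] m by simp
    moreover have "xpath n M m n \<in> carrier_mat (rk M (vpred n i)) (rk M n)"
      using xpath_carrier[OF s n_in, of m] i m vsucc_funpow[of m n] by (cases "m = 0") (auto simp: vpred_def)
    ultimately have "u i = xm M i * u m"
      using sized_xm[OF s i] W by (simp add: u_def assoc_mult_mat)
    then show ?thesis using m u0 by auto
  qed
  have dS: "d (n - (i - 1)) = ym M i * d (n - i)" if i: "i \<in> {2..n}" for i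
  proof -
    have e: "n - (i - 1) = Suc (n - i)" using i by auto
    have "(vpred n ^^ (n - i)) n = i" using vpred_funpow[of "n - i" n] i by simp
    then have "ypath n M (Suc (n - i)) n = ym M i * ypath n M (n - i) n" "ypath n M (n - i) n \<in> carrier_mat (rk M i) (rk M n)"
      using ypath_Suc_last[OF s n_in, of "n - i"] ypath_carrier[OF s n_in, of "n - i"] by auto
    then show ?thesis
      unfolding e d_def using sized_ym[OF s, of i] i W by (simp add: assoc_mult_mat)
  qed
  \<comment> \<open>The relation between \<open>x^k\<close> and \<open>y^(n-k)\<close> enters here:
    both directions give the same value at vertex \<open>k\<close>.\<close>
  have ud: "u k = d (n - k)"
    using CM_xpath_ypath[OF M n_in] unfolding u_def d_def by simp
  have pc: "\<psi> i \<in> carrier_mat (rk M i) r" if "i \<in> {1..n}" for i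
    using uc[OF that] dc[OF that] that by (auto simp: \<psi>_def)
  have px: "\<psi> i = xm M i * \<psi> (vpred n i)" if i: "i \<in> {1..k}" for i
    using uS[of i] i k d0 by (auto simp: \<psi>_def vpred_def)
  have py: "\<psi> (vpred n i) = ym M i * \<psi> i" if i: "i \<in> {1..n}" "i \<notin> {1..k}" for i
    using dS[of i] i k ud by (cases "i = Suc k") (auto simp: \<psi>_def vpred_def)
  have "\<psi> \<in> carrier (qrep_hom n (proj r) M)"
  proof (rule qrep_homI)
    fix i assume i: "i \<in> {1..n}"
    note j = vpred_in[OF i]
    have X: "A * (fps_X \<cdot>\<^sub>m 1\<^sub>m r) = fps_X \<cdot>\<^sub>m A" "(fps_X \<cdot>\<^sub>m 1\<^sub>m q) * A = fps_X \<cdot>\<^sub>m A"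
      if "A \<in> carrier_mat q r" for A :: "complex fps mat" and q
      using that mult_smult_distrib[OF that one_carrier_mat] mult_smult_assoc_mat[OF one_carrier_mat that]
      by auto
    show "\<psi> i * xm (proj r) i = xm M i * \<psi> (vpred n i)"
    proof (cases "i \<in> {1..k}")
      case True
      then show ?thesis
        unfolding xy_proj(1)[OF True] right_mult_one_mat[OF pc[OF i]] by (rule px)
    next
      case False
      \<comment> \<open>Beyond \<open>k\<close> the value at the preceding vertex was obtained by
        applying \<open>ym\<close>, so the condition for the opposite arrow follows from
        \<open>xy = t\<close>.\<close>
      have "xm M i * \<psi> (vpred n i) = xm M i * (ym M i * \<psi> i)" by (simp only: py[OF i False])
      also have "\<dots> = (xm M i * ym M i) * \<psi> i"
        by (rule assoc_mult_mat[OF sized_xm[OF s i] sized_ym[OF s i] pc[OF i], symmetric])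
      finally show ?thesis unfolding CM_xy[OF M i] xy_proj(3)[OF False] X[OF pc[OF i]] by simp
    qed
    show "\<psi> (vpred n i) * ym (proj r) i = ym M i * \<psi> i"
    proof (cases "i \<in> {1..k}")
      case True
      have "ym M i * \<psi> i = ym M i * (xm M i * \<psi> (vpred n i))" using px[OF True] by simp
      also have "\<dots> = (ym M i * xm M i) * \<psi> (vpred n i)"
        by (rule assoc_mult_mat[OF sized_ym[OF s i] sized_xm[OF s i] pc[OF j], symmetric])
      finally show ?thesis unfolding CM_yx[OF M i] xy_proj(2)[OF True] X[OF pc[OF j]] by simp
    next
      case False
      show ?thesis
        unfolding xy_proj(4)[OF False] right_mult_one_mat[OF pc[OF j]] by (rule py[OF i False])
    qed
  qed (use uc dc in \<open>auto simp: \<psi>_def\<close>)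
  moreover have "\<psi> n = W" using k d0 by (simp add: \<psi>_def)
  ultimately show ?thesis by blast
qed

text \<open>Only the images of the generators at vertex \<open>n\<close> have to be lifted. They are
  the columns of \<open>\<phi> n\<close>; preimages under \<open>\<pi> n\<close> form a matrix that
  extends freely to a homomorphism, and the composite is the given map because both agree at
  \<open>n\<close>.\<close>

lemma proj_projective:
  assumes CM: "proj r \<in> CM_modules k n"
  shows "CM_projective k n (proj r)"
  unfolding CM_projective_def
proof (intro conjI ballI impI CM)
  fix M N \<pi> \<phi>
  assume M: "M \<in> CM_modules k n" and N: "N \<in> CM_modules k n"
    and pi: "\<pi> \<in> carrier (qrep_hom n M N)" and surj: "qrep_surj n M N \<pi>"
    and phi: "\<phi> \<in> carrier (qrep_hom n (proj r) N)"
  note cp = qrep_homD(1)[OF pi n_in] and cf = qrep_homD(1)[OF phi n_in, unfolded rk_ds length_replicate]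
  have "\<forall>q<r. \<exists>w\<in>carrier_vec (rk M n). \<pi> n *\<^sub>v w = col (\<phi> n) q"
    using surj n_in cf unfolding qrep_surj_def by (metis col_carrier_vec carrier_matD)
  then obtain w where w: "\<And>q. q < r \<Longrightarrow> w q \<in> carrier_vec (rk M n)" "\<And>q. q < r \<Longrightarrow> \<pi> n *\<^sub>v w q = col (\<phi> n) q"
    by metis
  define W where "W = mat (rk M n) r (\<lambda>(p, q). w q $ p)"
  have W: "W \<in> carrier_mat (rk M n) r" by (simp add: W_def)
  have colW: "col W q = w q" if "q < r" for q
    using that w(1)[OF that] by (auto simp: W_def)
  have "\<pi> n * W = \<phi> n"
  proof (rule mat_col_eqI)
    fix q assume "q < dim_col (\<phi> n)"
    then have q: "q < r" using cf by simp
    then show "col (\<pi> n * W) q = col (\<phi> n) q"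
      using col_mult2[OF cp W q] w(2)[OF q] colW[OF q] by simp
  qed (use cp cf W in auto)
  moreover obtain \<psi> where psi: "\<psi> \<in> carrier (qrep_hom n (proj r) M)" "\<psi> n = W"
    using proj_hom_exists[OF M W] by blast
  ultimately have "qcomp n \<pi> \<psi> = \<phi>"
    using n_in by (intro proj_hom_eqI[OF qcomp_hom[OF sized_ds sized_if_CM[OF M] sized_if_CM[OF N] psi(1) pi] phi]) auto
  then show "\<exists>\<psi>\<in>carrier (qrep_hom n (proj r) M). Comp (CM_cat k n) (proj r) M N \<pi> \<psi> = \<phi>"
    using psi(1) by (auto simp: CM_cat_def)
qed

end

section \<open>Stable homomorphisms for \<open>(k, n) = (4, 8)\<close>\<close>

abbreviation src_labels :: "nat set set" where
  "src_labels \<equiv> {{1,2,4,5}, {1,2,3,6}}"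

abbreviation tgt_labels :: "nat set set" where
  "tgt_labels \<equiv> {{1,4,5,6}, {1,2,6,7}}"

section \<open>Numerical comparison of the labels\<close>

lemma cnt_numeral:
  "cnt I (numeral m) = cnt I (pred_numeral m) + (if numeral m \<in> I then 1 else 0)"
  "cnt I (Suc 0) = (if 1 \<in> I then 1 else 0)"
  using cnt_Suc[of I "pred_numeral m"] cnt_Suc[of I 0] by (simp_all add: numeral_eq_Suc)

lemma exp_numeral:
  "xexp n I (numeral m) i = xexp n I (pred_numeral m) (vsucc n i) + (if vsucc n i \<in> I then 0 else 1)"
  "yexp n I (numeral m) i = yexp n I (pred_numeral m) (vpred n i) + (if i \<in> I then 1 else 0)"
  by (simp_all add: numeral_eq_Suc)

lemma intervals: "{0..8::nat} = {0,1,2,3,4,5,6,7,8}" "{Suc 0..8} = {1,2,3,4,5,6,7,8}"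
    "{Suc 0..4} = {1,2,3,4}"
  by auto

text \<open>The inequality is what \<open>mono_hom\<close> needs for a map with shift 1 from a
  source summand to the projective at vertex 8. The count 3 at vertex 4, against 4 for
  \<open>{1..4}\<close>, excludes shift 0. In \<open>cnt_tgt\<close> the analogous inequality gives
  shift 0 from that projective to the targets.\<close>

lemma cnt_src:
  "\<forall>I\<in>src_labels. \<forall>i\<in>{0..8}. cnt {1..4} i \<le> Suc (cnt I i) \<and> cnt I 8 = 4 \<and> cnt I 4 = 3"
  by (simp add: intervals cnt_numeral)

lemma cnt_tgt:
  "\<forall>J\<in>tgt_labels. \<forall>i\<in>{0..8}. cnt J i \<le> cnt {1..4} i \<and> cnt J 8 = 4"
  by (simp add: intervals cnt_numeral)

text \<open>Shift 0 is allowed for every pair of a source and a target, so each matrix of constants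
  at vertex 8 extends to a homomorphism.\<close>

lemma cnt_src_tgt:
  "\<forall>I\<in>src_labels. \<forall>J\<in>tgt_labels. \<forall>i\<in>{0..8}. cnt J i \<le> cnt I i"
  by (simp add: intervals cnt_numeral)

text \<open>
  The sum of the three modules with these labels maps onto \<open>L\<^sub>J\<close> for both target labels \<open>J\<close>; the
  shifts are the least ones for which the three components are defined.
\<close>

definition cover_labels :: "nat set list" where
  "cover_labels = [{1..4}, {4,5,6,7}, {1,6,7,8}]"

definition cover_shift :: "nat set \<Rightarrow> nat \<Rightarrow> nat" where
  "cover_shift J q = (if q = 0 then 0 else if (q = 1) = (4 \<in> J) then 1 else 2)"

lemma cnt_cover:
  "\<forall>J\<in>tgt_labels. \<forall>q\<in>{0,1,2}. \<forall>i\<in>{0..8}. cnt J i \<le> cover_shift J q + cnt (cover_labels ! q) i \<and>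
     cnt (cover_labels ! q) 8 = 4"
  by (simp add: intervals cnt_numeral cover_labels_def cover_shift_def)

lemma vsucc_8: "vsucc 8 1 = 2" "vsucc 8 2 = 3" "vsucc 8 3 = 4" "vsucc 8 4 = 5" "vsucc 8 5 = 6"
    "vsucc 8 6 = 7" "vsucc 8 7 = 8" "vsucc 8 8 = 1"
  and vpred_8: "vpred 8 1 = 8" "vpred 8 2 = 1" "vpred 8 3 = 2" "vpred 8 4 = 3" "vpred 8 5 = 4"
    "vpred 8 6 = 5" "vpred 8 7 = 6" "vpred 8 8 = 7"
  by (simp_all add: vsucc_def vpred_def)

lemma cnt_cover_surj:
  "\<forall>J\<in>tgt_labels. \<forall>i\<in>{1..8}. \<exists>q\<in>{0,1,2}. cover_shift J q + cnt (cover_labels ! q) i - cnt J i = 0"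
  by (simp add: intervals cnt_numeral cover_labels_def cover_shift_def)

text \<open>The labels are those of the projective at vertex 8, of the two targets and of the two
  other summands of the cover: the lifting property is applied over a target, with the cover above
  it.\<close>

lemma exp_CM:
  "\<forall>I\<in>{{1..4},{1,4,5,6},{1,2,6,7},{4,5,6,7},{1,6,7,8}}. \<forall>i\<in>{1..8}. xexp 8 I 4 i = yexp 8 I 4 i"
  by (simp add: intervals exp_numeral vsucc_8[simplified] vpred_8[simplified])

interpretation P: proj_n 4 8 by unfold_locales auto

lemma CM_if_labels:
  assumes "set Is \<subseteq> {{1..4},{1,4,5,6},{1,2,6,7},{4,5,6,7},{1,6,7,8}}"
  shows "ds Is \<in> CM_modules 4 8"
proof (rule ds_CM)
  fix I i assume I: "I \<in> set Is" and i: "i \<in> {1..8::nat}"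
  from bspec[OF bspec[OF exp_CM subsetD[OF assms I]] i]
  show "xexp 8 I 4 i = yexp 8 I (8 - 4) i" by simp
qed

lemma proj_projective: "CM_projective 4 8 (P.proj r)"
  by (rule P.proj_projective[OF CM_if_labels])
    (simp only: set_replicate_conv_if insert_subset insert_iff empty_subsetI simp_thms split: if_split)

text \<open>By \<open>qrep_hom_ds_cnt\<close> the entry at \<open>n\<close> is the entry at
  \<open>i\<close> times a positive power of \<open>fps_X\<close>. A single vertex where the target
  count exceeds the source count thus kills the constant term.\<close>

lemma coeff_zero_if_cnt_less:
  assumes phi: "\<phi> \<in> carrier (qrep_hom n (ds Is) (ds Js))"
    and pq: "p < length Js" "q < length Is" and i: "i \<in> {1..n}" and less: "cnt (Is ! q) i < cnt (Js ! p) i"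
  shows "fps_nth (\<phi> n $$ (p, q)) 0 = 0"
proof -
  let ?a = "cnt (Is ! q) i"
  obtain d where d: "cnt (Js ! p) i = ?a + Suc d" using less less_iff_Suc_add by auto
  have "fps_X ^ ?a * (\<phi> i $$ (p, q) * fps_X ^ d * fps_X) = fps_X ^ ?a * \<phi> n $$ (p, q)"
    using qrep_hom_ds_cnt[OF phi pq i] unfolding d by (simp add: power_add mult_ac)
  then have "\<phi> n $$ (p, q) = \<phi> i $$ (p, q) * fps_X ^ d * fps_X" by simp
  then show ?thesis by simp
qed

lemma Comp_CM_cat: "Comp (CM_cat k n) L M N \<psi> \<phi> = qcomp n \<psi> \<phi>"
  by (simp add: CM_cat_def)

lemma CM_projective_lift:
  assumes "CM_projective k n P" "M \<in> CM_modules k n" "N \<in> CM_modules k n"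
    "\<pi> \<in> carrier (qrep_hom n M N)" "qrep_surj n M N \<pi>" "\<phi> \<in> carrier (qrep_hom n P N)"
  shows "\<exists>\<psi>\<in>carrier (qrep_hom n P M). qcomp n \<pi> \<psi> = \<phi>"
  using assms unfolding CM_projective_def Comp_CM_cat by blast

text \<open>At every vertex one of the three exponents is zero, and that entry alone reaches every
  vector. The target with label \<open>{1,4,5,6}\<close> is generated at the vertices 8 and 3, the
  one with label \<open>{1,2,6,7}\<close> at 8 and 5; the cover consists of the projectives at these
  three vertices and serves both. The test \<open>4 \<in> J\<close> in \<open>cover_shift\<close>
  tells the two targets apart.\<close>

lemma cover_surj:
  assumes J: "J \<in> tgt_labels"
  defines "\<pi> \<equiv> mono_hom 8 cover_labels [J] (\<lambda>p q. cover_shift J q) (mat 1 3 (\<lambda>_. 1))"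
  shows "\<pi> \<in> carrier (qrep_hom 8 (ds cover_labels) (ds [J]))"
    "qrep_surj 8 (ds cover_labels) (ds [J]) \<pi>"
proof -
  have len: "length cover_labels = 3" by (simp add: cover_labels_def)
  have q3: "q \<in> {0,1,2}" if "q < 3" for q :: nat using that by auto
  show "\<pi> \<in> carrier (qrep_hom 8 (ds cover_labels) (ds [J]))"
    unfolding \<pi>_def
  proof (rule mono_hom_hom)
    fix i p q :: nat assume "i \<le> 8" "p < length [J]" "q < length cover_labels"
    then have "i \<in> {0..8}" "q \<in> {0,1,2}" "p = 0" using q3 by (auto simp: len)
    then show "cnt ([J] ! p) i \<le> cover_shift J q + cnt (cover_labels ! q) i"
      using bspec[OF bspec[OF bspec[OF cnt_cover J]], of q i] by simp
  next
    fix p q :: nat assume "p < length [J]" "q < length cover_labels"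
    then have "q \<in> {0,1,2}" "p = 0" using q3 by (auto simp: len)
    then show "cnt ([J] ! p) 8 = cnt (cover_labels ! q) 8"
      using bspec[OF bspec[OF bspec[OF cnt_cover J]], of q 8] bspec[OF bspec[OF cnt_tgt J], of 8] by simp
  qed
  show "qrep_surj 8 (ds cover_labels) (ds [J]) \<pi>"
    unfolding qrep_surj_def rk_ds len
  proof (intro ballI)
    fix i :: nat and v :: "complex fps vec" assume i: "i \<in> {1..8}" and v: "v \<in> carrier_vec (length [J])"
    from bspec[OF bspec[OF cnt_cover_surj J] i] obtain q where
      "q \<in> {0,1,2}" and q: "cover_shift J q + cnt (cover_labels ! q) i - cnt J i = 0" by blast
    then have q3: "q < 3" by auto
    define w where "w = v $ 0 \<cdot>\<^sub>v (unit_vec 3 q :: complex fps vec)"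
    have w: "w \<in> carrier_vec 3" by (simp add: w_def)
    have c: "\<pi> i \<in> carrier_mat 1 3" using i by (simp add: \<pi>_def mono_hom_def len)
    note q = q3 q
    have "row (\<pi> i) 0 \<bullet> w = v $ 0 * \<pi> i $$ (0, q)"
      using c q by (simp add: w_def scalar_prod_smult_distrib[where n = 3])
    also have "\<pi> i $$ (0, q) = 1"
      using i q by (simp add: \<pi>_def mono_hom_def len)
    finally have "\<pi> i *\<^sub>v w = v" using c v by (intro eq_vecI) auto
    with w show "\<exists>w\<in>carrier_vec 3. \<pi> i *\<^sub>v w = v" by blast
  qed
qed

lemma proj_ideal_coeff_zero:
  assumes Is: "set Is \<subseteq> src_labels" and Js: "set Js \<subseteq> tgt_labels"
    and phi: "\<phi> \<in> proj_ideal 4 8 (ds Is) (ds Js)"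
    and pq: "p < length Js" "q < length Is"
  shows "fps_nth (\<phi> 8 $$ (p, q)) 0 = 0"
  \<comment> \<open>The second factor of a map through a projective lifts to the cover of \<open>L\<^sub>J\<close>, so it suffices to
    consider the three maps through the summands of the cover.\<close>
proof -
  let ?J = "Js ! p" and ?r = "length Is"
  have J: "?J \<in> tgt_labels" by (rule subsetD[OF Js nth_mem[OF pq(1)]])
  from phi obtain Q \<alpha> \<beta> where Q: "CM_projective 4 8 Q"
    and al: "\<alpha> \<in> carrier (qrep_hom 8 (ds Is) Q)" and be: "\<beta> \<in> carrier (qrep_hom 8 Q (ds Js))"
    and phi': "\<phi> = qcomp 8 \<beta> \<alpha>"
    by (auto simp: proj_ideal_def CM_cat_def)
  have sQ: "sized 8 Q" using Q by (auto simp: CM_projective_def intro: sized_if_CM)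
  \<comment> \<open>Projection to the \<open>p\<close>-th summand: the shifts of the cover depend on
    the label, so one target summand is treated at a time.\<close>
  define \<rho> where "\<rho> = (\<lambda>i\<in>{1..8::nat}. mat 1 (length Js) (\<lambda>(_, q). if q = p then 1 else 0 :: complex fps))"
  have rho: "\<rho> \<in> carrier (qrep_hom 8 (ds Js) (ds [?J]))"
    by (rule qrep_hom_dsI) (auto simp: \<rho>_def vpred_def)
  define \<pi> where "\<pi> = mono_hom 8 cover_labels [?J] (\<lambda>p q. cover_shift ?J q) (mat 1 3 (\<lambda>_. 1))"
  note pi = cover_surj[OF J, folded \<pi>_def]
  have CM: "ds cover_labels \<in> CM_modules 4 8" "ds [?J] \<in> CM_modules 4 8"
    using J by (intro CM_if_labels;
      simp only: cover_labels_def list.set insert_subset insert_iff empty_subsetI simp_thms; blast)+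
  have "qcomp 8 \<rho> \<beta> \<in> carrier (qrep_hom 8 Q (ds [?J]))"
    by (rule qcomp_hom[OF sQ sized_ds sized_ds be rho])
  from CM_projective_lift[OF Q CM pi this]
  obtain \<gamma> where ga: "\<gamma> \<in> carrier (qrep_hom 8 Q (ds cover_labels))" "qcomp 8 \<pi> \<gamma> = qcomp 8 \<rho> \<beta>"
    by blast
  define \<delta> where "\<delta> = qcomp 8 \<gamma> \<alpha>"
  have de: "\<delta> \<in> carrier (qrep_hom 8 (ds Is) (ds cover_labels))"
    unfolding \<delta>_def by (rule qcomp_hom[OF sized_ds sQ sized_ds al ga(1)])
  have "qcomp 8 \<rho> \<phi> = qcomp 8 \<pi> \<delta>"
    unfolding phi' \<delta>_def qcomp_assoc[OF al be rho] qcomp_assoc[OF al ga(1) pi(1)] ga(2) ..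
  then have eq: "\<rho> 8 * \<phi> 8 = \<pi> 8 * \<delta> 8" by (auto dest: fun_cong[of _ _ 8])
  have "\<phi> \<in> carrier (qrep_hom 8 (ds Is) (ds Js))"
    unfolding phi' by (rule qcomp_hom[OF sized_ds sQ sized_ds al be])
  from qrep_homD(1)[OF this, of 8] have c: "\<phi> 8 \<in> carrier_mat (length Js) ?r" by simp
  have len: "length cover_labels = 3" by (simp add: cover_labels_def)
  from qrep_homD(1)[OF de, of 8] have d: "\<delta> 8 \<in> carrier_mat 3 ?r" by (simp add: len)
  \<comment> \<open>All counts at vertex 8 equal 4, so the exponents there are the bare
    shifts.\<close>
  have pi8: "\<pi> 8 = mat 1 3 (\<lambda>(_, s). fps_X ^ cover_shift ?J s)"
  proof (rule eq_matI)
    fix r s :: nat assume "r < dim_row (mat 1 3 (\<lambda>(_, s). fps_X ^ cover_shift ?J s :: complex fps))"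
      "s < dim_col (mat 1 3 (\<lambda>(_, s). fps_X ^ cover_shift ?J s :: complex fps))"
    then have s: "s < 3" "r = 0" by auto
    then have "s \<in> {0,1,2}" by auto
    then have "cnt (cover_labels ! s) 8 = 4" "cnt ?J 8 = 4"
      using bspec[OF bspec[OF bspec[OF cnt_cover J]], of s 8] bspec[OF bspec[OF cnt_tgt J], of 8]
      by simp_all
    then show "\<pi> 8 $$ (r, s) = mat 1 3 (\<lambda>(_, s). fps_X ^ cover_shift ?J s) $$ (r, s)"
      using s by (simp add: \<pi>_def mono_hom_def len)
  qed (simp_all add: \<pi>_def mono_hom_def len)
  have "(\<rho> 8 * \<phi> 8) $$ (0, q) = (\<Sum>s<length Js. (if s = p then 1 else 0) * \<phi> 8 $$ (s, q))"
    using c pq by (simp add: \<rho>_def scalar_prod_def atLeast0LessThan)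
  also have "\<dots> = (\<Sum>s<length Js. if s = p then \<phi> 8 $$ (s, q) else 0)"
    by (rule sum.cong) auto
  also have "\<dots> = \<phi> 8 $$ (p, q)" using pq by simp
  finally have "\<phi> 8 $$ (p, q) = (\<Sum>s<3. fps_X ^ cover_shift ?J s * \<delta> 8 $$ (s, q))"
    unfolding eq pi8 using d pq by (simp add: scalar_prod_def atLeast0LessThan)
  \<comment> \<open>The shift vanishes only for \<open>s = 0\<close>. In that case the map from the
    source to the projective at vertex 8 has no constant term, as the counts at vertex 4 are 3 and
    4. In the other cases the power of \<open>fps_X\<close> is positive.\<close>
  moreover have "fps_nth (fps_X ^ cover_shift ?J s * \<delta> 8 $$ (s, q)) 0 = 0" if s: "s < 3" for s
  proof (cases "s = 0")
    case True
    have "Is ! q \<in> src_labels" by (rule subsetD[OF Is nth_mem[OF pq(2)]])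
    from bspec[OF bspec[OF cnt_src this], of 4] have "cnt (Is ! q) 4 < cnt (cover_labels ! 0) 4"
      by (simp add: cover_labels_def cnt_numeral)
    then have "fps_nth (\<delta> 8 $$ (0, q)) 0 = 0"
      by (intro coeff_zero_if_cnt_less[OF de]) (use pq len in auto)
    then show ?thesis using True by simp
  next
    case False
    then have "cover_shift ?J s = Suc 0 \<or> cover_shift ?J s = Suc (Suc 0)" by (simp add: cover_shift_def)
    then show ?thesis by auto
  qed
  ultimately show ?thesis by (auto simp only: fps_sum_nth lessThan_iff intro!: sum.neutral)
qed

text \<open>Vanishing constant terms let one factor \<open>fps_X\<close> be split off at vertex 8.
  This factor is absorbed by the shift 1 of the map from each source summand to its own copy of the
  projective; the quotient matrix \<open>C\<close> then describes a map of shift 0 from the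
  projective to the targets.\<close>

lemma proj_ideal_if_coeff_zero:
  assumes Is: "set Is \<subseteq> src_labels" and Js: "set Js \<subseteq> tgt_labels"
    and phi: "\<phi> \<in> carrier (qrep_hom 8 (ds Is) (ds Js))"
    and coeff: "\<And>p q. p < length Js \<Longrightarrow> q < length Is \<Longrightarrow> fps_nth (\<phi> 8 $$ (p, q)) 0 = 0"
  shows "\<phi> \<in> proj_ideal 4 8 (ds Is) (ds Js)"
proof -
  let ?m = "length Is"
  define C where "C = mat (length Js) ?m (\<lambda>pq. fps_shift 1 (\<phi> 8 $$ pq))"
  have phi8: "\<phi> 8 $$ (p, q) = fps_X * C $$ (p, q)" if "p < length Js" "q < ?m" for p q
    using coeff[OF that] that by (intro fps_ext) (simp add: C_def fps_X_mult_nth)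
  define \<alpha> where "\<alpha> = mono_hom 8 Is (replicate ?m {1..4}) (\<lambda>_ _. 1) (1\<^sub>m ?m)"
  define \<beta> where "\<beta> = mono_hom 8 (replicate ?m {1..4}) Js (\<lambda>_ _. 0) C"
  have src: "cnt {1..4} i \<le> Suc (cnt (Is ! q) i)" "cnt (Is ! q) 8 = 4" if "q < ?m" "i \<le> 8" for q i
    using bspec[OF bspec[OF cnt_src subsetD[OF Is nth_mem[OF that(1)]]], of i] that(2)
    by simp_all
  have tgt: "cnt (Js ! p) i \<le> cnt {1..4} i" "cnt (Js ! p) 8 = 4" if "p < length Js" "i \<le> 8" for p i
    using bspec[OF bspec[OF cnt_tgt subsetD[OF Js nth_mem[OF that(1)]]], of i] that(2)
    by simp_all
  have P8: "cnt {1..4} 8 = 4" by (simp add: cnt_numeral)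
  have al: "\<alpha> \<in> carrier (qrep_hom 8 (ds Is) (P.proj ?m))"
    unfolding \<alpha>_def by (rule mono_hom_hom) (use src P8 in \<open>auto\<close>)
  have be: "\<beta> \<in> carrier (qrep_hom 8 (P.proj ?m) (ds Js))"
    unfolding \<beta>_def by (rule mono_hom_hom) (use tgt P8 in \<open>auto\<close>)
  have "\<phi> = qcomp 8 \<beta> \<alpha>"
  proof (rule qrep_hom_ext[OF phi qcomp_hom[OF sized_ds sized_ds sized_ds al be]])
    fix i :: nat assume i: "i \<in> {1..8}"
    show "\<phi> i = qcomp 8 \<beta> \<alpha> i"
    proof (rule eq_matI)
      fix p q assume "p < dim_row (qcomp 8 \<beta> \<alpha> i)" "q < dim_col (qcomp 8 \<beta> \<alpha> i)"
      then have pq: "p < length Js" "q < ?m" using i by (auto simp: \<alpha>_def \<beta>_def mono_hom_def)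
      let ?P = "cnt {1..4} i" and ?I = "cnt (Is ! q) i" and ?J = "cnt (Js ! p) i"
      have "(\<beta> i * \<alpha> i) $$ (p, q) = (\<Sum>s<?m. fps_X ^ (?P - ?J) * C $$ (p, s) *
          (fps_X ^ (Suc ?I - ?P) * (if s = q then 1 else 0)))"
        using i pq by (simp add: \<alpha>_def \<beta>_def mono_hom_def scalar_prod_def atLeast0LessThan)
      also have "\<dots> = (\<Sum>s<?m. if s = q then fps_X ^ (?P - ?J) * C $$ (p, s) * fps_X ^ (Suc ?I - ?P) else 0)"
        by (rule sum.cong) auto
      also have "\<dots> = fps_X ^ ((?P - ?J) + (Suc ?I - ?P)) * C $$ (p, q)"
        using pq by (simp add: power_add mult_ac)
      \<comment> \<open>Multiplication by \<open>fps_X ^ ?J\<close> makes the truncated differences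
        add up to \<open>Suc ?I\<close>, the exponent delivered by \<open>qrep_hom_ds_cnt\<close>
        together with the factor split off in \<open>phi8\<close>.\<close>
      finally have "(\<beta> i * \<alpha> i) $$ (p, q) * fps_X ^ ?J = fps_X ^ ((?P - ?J) + (Suc ?I - ?P) + ?J) * C $$ (p, q)"
        by (simp add: power_add mult_ac)
      also have "(?P - ?J) + (Suc ?I - ?P) + ?J = Suc ?I"
        using src(1)[OF pq(2), of i] tgt(1)[OF pq(1), of i] i by simp
      also have "fps_X ^ Suc ?I * C $$ (p, q) = fps_X ^ ?I * \<phi> 8 $$ (p, q)"
        using phi8[OF pq] by (simp add: mult_ac)
      also have "\<dots> = \<phi> i $$ (p, q) * fps_X ^ ?J"
        using qrep_hom_ds_cnt[OF phi pq i] by simp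
      finally show "\<phi> i $$ (p, q) = qcomp 8 \<beta> \<alpha> i $$ (p, q)" using i by simp
    qed (use i qrep_homD(1)[OF phi i] in \<open>auto simp: \<alpha>_def \<beta>_def mono_hom_def\<close>)
  qed
  then show ?thesis
    unfolding proj_ideal_def using al be proj_projective by (auto simp: CM_cat_def)
qed

section \<open>Two-term complexes\<close>

definition zero_space :: "(complex, 'm) module \<Rightarrow> bool" where
  "zero_space M \<longleftrightarrow> vectorspace (class_ring :: complex ring) M \<and> carrier M = {\<zero>\<^bsub>M\<^esub>}"

lemma zero_spaceD:
  assumes "zero_space M"
  shows "x \<in> carrier M \<longleftrightarrow> x = \<zero>\<^bsub>M\<^esub>" "\<zero>\<^bsub>M\<^esub> \<oplus>\<^bsub>M\<^esub> \<zero>\<^bsub>M\<^esub> = \<zero>\<^bsub>M\<^esub>" "c \<odot>\<^bsub>M\<^esub> \<zero>\<^bsub>M\<^esub> = \<zero>\<^bsub>M\<^esub>"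
    "\<ominus>\<^bsub>M\<^esub> \<zero>\<^bsub>M\<^esub> = \<zero>\<^bsub>M\<^esub>"
proof -
  interpret vectorspace "class_ring :: complex ring" M using assms by (simp add: zero_space_def)
  show "x \<in> carrier M \<longleftrightarrow> x = \<zero>\<^bsub>M\<^esub>" using assms by (auto simp: zero_space_def)
  show "\<zero>\<^bsub>M\<^esub> \<oplus>\<^bsub>M\<^esub> \<zero>\<^bsub>M\<^esub> = \<zero>\<^bsub>M\<^esub>" "\<ominus>\<^bsub>M\<^esub> \<zero>\<^bsub>M\<^esub> = \<zero>\<^bsub>M\<^esub>"
    using M.a_inv_closed[OF M.zero_closed] assms by (simp_all add: zero_space_def)
  have "c \<odot>\<^bsub>M\<^esub> \<zero>\<^bsub>M\<^esub> \<in> carrier M" by (rule smult_closed) auto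
  then show "c \<odot>\<^bsub>M\<^esub> \<zero>\<^bsub>M\<^esub> = \<zero>\<^bsub>M\<^esub>" using assms by (simp add: zero_space_def)
qed

text \<open>A two-term complex and its shift involve only the objects \<open>Z\<close>,
  \<open>N\<close> and \<open>P\<close>, so the hypotheses constrain the category on these three
  alone; \<open>Z\<close> behaves as a zero object among them.\<close>

locale two_term_complex =
  fixes \<A> :: "('o, 'm) lincat" and Z N P :: 'o and f :: 'm
  assumes vs: "vectorspace (class_ring :: complex ring) (Mor \<A> N P)"
    and f: "f \<in> carrier (Mor \<A> N P)"
    and to_Z: "\<And>X. X \<in> {Z, N, P} \<Longrightarrow> zero_space (Mor \<A> X Z)"
    and from_Z: "\<And>X. X \<in> {Z, N, P} \<Longrightarrow> zero_space (Mor \<A> Z X)"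
    and comp: "\<And>X Y W g h. X \<in> {Z, N, P} \<Longrightarrow> Y \<in> {Z, N, P} \<Longrightarrow> W \<in> {Z, N, P} \<Longrightarrow>
      X = Z \<or> W = Z \<or> X = N \<and> W = P \<and> Y \<noteq> Z \<Longrightarrow>
      h \<in> carrier (Mor \<A> X Y) \<Longrightarrow> g \<in> carrier (Mor \<A> Y W) \<Longrightarrow> Comp \<A> X Y W g h \<in> carrier (Mor \<A> X W)"
begin

sublocale V: vectorspace "class_ring :: complex ring" "Mor \<A> N P" by (rule vs)

abbreviation T :: "('o, 'm) cochain" where "T \<equiv> two_term \<A> Z N P f"
abbreviation T' :: "('o, 'm) cochain" where "T' \<equiv> shift \<A> T"

text \<open>The complex occupies the degrees -1 and 0, its shift the degrees -2 and -1. They overlap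
  only in degree -1, where a chain map is a morphism from \<open>N\<close> to
  \<open>P\<close>.\<close>

definition conc :: "'m \<Rightarrow> int \<Rightarrow> 'm" where
  "conc v i = (if i = -1 then v else \<zero>\<^bsub>Mor \<A> (ob T i) (ob T' i)\<^esub>)"

text \<open>A homotopy has at most two nonzero components, \<open>a\<close> on \<open>N\<close> in
  degree -1 and \<open>b\<close> on \<open>P\<close> in degree 0. The sign is that of the shifted
  differential.\<close>

definition U :: "'m set" where
  "U = {Comp \<A> N N P (\<ominus>\<^bsub>Mor \<A> N P\<^esub> f) a \<oplus>\<^bsub>Mor \<A> N P\<^esub> Comp \<A> N P P b f | a b.
     a \<in> carrier (Mor \<A> N N) \<and> b \<in> carrier (Mor \<A> P P)}"

lemma ob_T: "ob T i = (if i = -1 then N else if i = 0 then P else Z)"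
  and ob_T': "ob T' i = (if i = -2 then N else if i = -1 then P else Z)"
  by (auto simp: two_term_def shift_def Let_def)

lemma ob_in: "ob T i \<in> {Z, N, P}" "ob T' i \<in> {Z, N, P}"
  by (auto simp: ob_T ob_T')

lemma zero_space_if:
  assumes "X \<in> {Z, N, P}" "Y \<in> {Z, N, P}" "X = Z \<or> Y = Z"
  shows "zero_space (Mor \<A> X Y)"
  using assms to_Z from_Z by auto

lemma zero_space_T: "i \<noteq> -1 \<Longrightarrow> zero_space (Mor \<A> (ob T i) (ob T' i))"
  and zero_space_T_Suc: "zero_space (Mor \<A> (ob T i) (ob T' (i + 1)))"
  by (rule zero_space_if[OF ob_in]; auto simp: ob_T ob_T')+

lemma df_T: "df T i \<in> carrier (Mor \<A> (ob T i) (ob T (i + 1)))"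
proof (cases "i = -1")
  case False
  then have "zero_space (Mor \<A> (ob T i) (ob T (i + 1)))"
    by (intro zero_space_if ob_in) (auto simp: ob_T)
  then show ?thesis using False
    by (auto simp: two_term_def Let_def zero_space_def)
qed (use f in \<open>simp add: two_term_def\<close>)

lemma df_T': "df T' i \<in> carrier (Mor \<A> (ob T' i) (ob T' (i + 1)))"
proof (cases "i = -2")
  case True
  then show ?thesis using f by (simp add: two_term_def shift_def)
next
  case False
  then have zs: "zero_space (Mor \<A> (ob T' i) (ob T' (i + 1)))"
    by (intro zero_space_if ob_in) (auto simp: ob_T')
  have ob: "ob T' i = ob T (i + 1)" "ob T' (i + 1) = ob T (i + 1 + 1)" by (simp_all add: shift_def)
  have "df T (i + 1) = \<zero>\<^bsub>Mor \<A> (ob T (i + 1)) (ob T (i + 1 + 1))\<^esub>"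
    using df_T[of "i + 1"] zero_spaceD(1)[OF zs] unfolding ob by blast
  then have "df T' i = \<zero>\<^bsub>Mor \<A> (ob T' i) (ob T' (i + 1))\<^esub>"
    using zero_spaceD(4)[OF zs] unfolding ob by (simp add: shift_def)
  then show ?thesis using zero_spaceD(1)[OF zs] by blast
qed

lemma df_T'_2: "df T' (-2) = \<ominus>\<^bsub>Mor \<A> N P\<^esub> f" and df_T_1: "df T (-1) = f"
  by (simp_all add: two_term_def shift_def)

lemma conc_closed: "v \<in> carrier (Mor \<A> N P) \<Longrightarrow> conc v i \<in> carrier (Mor \<A> (ob T i) (ob T' i))"
  using zero_spaceD(1)[OF zero_space_T[of i]] by (auto simp: conc_def ob_T ob_T')

text \<open>Each commutation square runs from degree \<open>i\<close> of the complex to degree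
  \<open>i + 1\<close> of its shift, and one of these two objects is always \<open>Z\<close>. So the
  squares impose no condition.\<close>

lemma chain_maps_carrier: "carrier (chain_maps \<A> T T') = conc ` carrier (Mor \<A> N P)"
proof (intro equalityI subsetI)
  fix \<phi> assume "\<phi> \<in> carrier (chain_maps \<A> T T')"
  then have mor: "\<phi> i \<in> carrier (Mor \<A> (ob T i) (ob T' i))" for i by (simp add: chain_maps_def)
  have "\<phi> = conc (\<phi> (-1))"
    using mor zero_spaceD(1)[OF zero_space_T] by (intro ext) (auto simp: conc_def)
  moreover have "\<phi> (-1) \<in> carrier (Mor \<A> N P)" using mor[of "-1"] by (simp add: ob_T ob_T')
  ultimately show "\<phi> \<in> conc ` carrier (Mor \<A> N P)" by blast
next
  fix \<phi> assume "\<phi> \<in> conc ` carrier (Mor \<A> N P)"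
  then obtain v where v: "v \<in> carrier (Mor \<A> N P)" "\<phi> = conc v" by blast
  note c = conc_closed[OF v(1)]
  have "Comp \<A> (ob T i) (ob T' i) (ob T' (i + 1)) (df T' i) (conc v i) =
      Comp \<A> (ob T i) (ob T (i + 1)) (ob T' (i + 1)) (conc v (i + 1)) (df T i)" for i
  proof -
    have Z: "ob T i = Z \<or> ob T' (i + 1) = Z" by (auto simp: ob_T ob_T')
    have "Comp \<A> (ob T i) (ob T' i) (ob T' (i + 1)) (df T' i) (conc v i) \<in> carrier (Mor \<A> (ob T i) (ob T' (i + 1)))"
      using Z by (intro comp ob_in c df_T') auto
    moreover have "Comp \<A> (ob T i) (ob T (i + 1)) (ob T' (i + 1)) (conc v (i + 1)) (df T i) \<in> carrier (Mor \<A> (ob T i) (ob T' (i + 1)))"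
      using Z by (intro comp ob_in c df_T) auto
    ultimately show ?thesis using zero_spaceD(1)[OF zero_space_T_Suc[of i]] by metis
  qed
  then show "\<phi> \<in> carrier (chain_maps \<A> T T')" using c by (simp add: chain_maps_def v(2))
qed

lemma null_homotopic_eq: "null_homotopic \<A> T T' = conc ` U"
proof (intro equalityI subsetI)
  fix \<phi> assume "\<phi> \<in> null_homotopic \<A> T T'"
  then obtain s where s: "\<And>i. s i \<in> carrier (Mor \<A> (ob T i) (ob T' (i - 1)))"
    and phi: "\<And>i. \<phi> i = Comp \<A> (ob T i) (ob T' (i - 1)) (ob T' i) (df T' (i - 1)) (s i)
        \<oplus>\<^bsub>Mor \<A> (ob T i) (ob T' i)\<^esub> Comp \<A> (ob T i) (ob T (i + 1)) (ob T' i) (s (i + 1)) (df T i)"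
    unfolding null_homotopic_def by auto
  have "\<phi> i = conc (\<phi> (-1)) i" for i
  proof (cases "i = -1")
    case False
    note zs = zero_space_T[OF False]
    have Z: "ob T i = Z \<or> ob T' i = Z" using False by (auto simp: ob_T ob_T')
    have "Comp \<A> (ob T i) (ob T' (i - 1)) (ob T' i) (df T' (i - 1)) (s i) \<in> carrier (Mor \<A> (ob T i) (ob T' i))"
      using Z df_T'[of "i - 1"] by (intro comp ob_in s) auto
    moreover have "Comp \<A> (ob T i) (ob T (i + 1)) (ob T' i) (s (i + 1)) (df T i) \<in> carrier (Mor \<A> (ob T i) (ob T' i))"
      using Z s[of "i + 1"] by (intro comp ob_in df_T) auto
    ultimately have "\<phi> i = \<zero>\<^bsub>Mor \<A> (ob T i) (ob T' i)\<^esub>"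
      unfolding phi zero_spaceD(1)[OF zs] using zero_spaceD(2)[OF zs] by simp
    then show ?thesis using False by (simp add: conc_def)
  qed (simp add: conc_def)
  moreover have "\<phi> (-1) \<in> U"
    using s[of "-1"] s[of 0] phi[of "-1"] unfolding U_def
    by (auto simp: ob_T ob_T' df_T'_2 df_T_1)
  ultimately show "\<phi> \<in> conc ` U" by blast
next
  fix \<phi> assume "\<phi> \<in> conc ` U"
  then obtain a b where a: "a \<in> carrier (Mor \<A> N N)" and b: "b \<in> carrier (Mor \<A> P P)"
    and phi: "\<phi> = conc (Comp \<A> N N P (\<ominus>\<^bsub>Mor \<A> N P\<^esub> f) a \<oplus>\<^bsub>Mor \<A> N P\<^esub> Comp \<A> N P P b f)"
    unfolding U_def by auto
  define s where "s i = (if i = -1 then a else if i = 0 then b else \<zero>\<^bsub>Mor \<A> (ob T i) (ob T' (i - 1))\<^esub>)" for i :: int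
  have s: "s i \<in> carrier (Mor \<A> (ob T i) (ob T' (i - 1)))" for i
  proof (cases "i = -1 \<or> i = 0")
    case True
    then show ?thesis using a b by (auto simp: s_def ob_T ob_T')
  next
    case False
    then have "zero_space (Mor \<A> (ob T i) (ob T' (i - 1)))"
      by (intro zero_space_if ob_in) (auto simp: ob_T)
    then show ?thesis using False by (auto simp: s_def zero_space_def)
  qed
  have "\<phi> i = Comp \<A> (ob T i) (ob T' (i - 1)) (ob T' i) (df T' (i - 1)) (s i)
        \<oplus>\<^bsub>Mor \<A> (ob T i) (ob T' i)\<^esub> Comp \<A> (ob T i) (ob T (i + 1)) (ob T' i) (s (i + 1)) (df T i)" for i
  proof (cases "i = -1")
    case True
    then show ?thesis unfolding phi by (simp add: conc_def s_def ob_T ob_T' df_T'_2 df_T_1)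
  next
    case False
    note zs = zero_space_T[OF False]
    have Z: "ob T i = Z \<or> ob T' i = Z" using False by (auto simp: ob_T ob_T')
    have "Comp \<A> (ob T i) (ob T' (i - 1)) (ob T' i) (df T' (i - 1)) (s i) \<in> carrier (Mor \<A> (ob T i) (ob T' i))"
      using Z df_T'[of "i - 1"] by (intro comp ob_in s) auto
    moreover have "Comp \<A> (ob T i) (ob T (i + 1)) (ob T' i) (s (i + 1)) (df T i) \<in> carrier (Mor \<A> (ob T i) (ob T' i))"
      using Z s[of "i + 1"] by (intro comp ob_in df_T) auto
    ultimately show ?thesis
      unfolding phi zero_spaceD(1)[OF zs] using zero_spaceD(2)[OF zs] False by (simp add: conc_def)
  qed
  with s show "\<phi> \<in> null_homotopic \<A> T T'" unfolding null_homotopic_def by blast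
qed

lemma conc_inj: "conc v = conc w \<Longrightarrow> v = w"
  by (drule fun_cong[of _ _ "-1"]) (simp add: conc_def)

lemma conc_add: "conc v \<oplus>\<^bsub>chain_maps \<A> T T'\<^esub> conc w = conc (v \<oplus>\<^bsub>Mor \<A> N P\<^esub> w)"
  using zero_spaceD(2)[OF zero_space_T]
  by (intro ext) (auto simp: chain_maps_def conc_def ob_T[of "-1"] ob_T'[of "-1"])

lemma conc_smult: "c \<odot>\<^bsub>chain_maps \<A> T T'\<^esub> conc v = conc (c \<odot>\<^bsub>Mor \<A> N P\<^esub> v)"
  using zero_spaceD(3)[OF zero_space_T]
  by (intro ext) (auto simp: chain_maps_def conc_def ob_T[of "-1"] ob_T'[of "-1"])

lemma conc_zero: "\<zero>\<^bsub>chain_maps \<A> T T'\<^esub> = conc \<zero>\<^bsub>Mor \<A> N P\<^esub>"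
  by (intro ext) (auto simp: chain_maps_def conc_def ob_T[of "-1"] ob_T'[of "-1"])

lemma chain_maps_vectorspace:
  "vectorspace class_ring (chain_maps \<A> T T')"
  "linear_map class_ring (Mor \<A> N P) (chain_maps \<A> T T') conc"
  by (rule vectorspace_surj_image[OF vs chain_maps_carrier conc_zero conc_add conc_smult])+

text \<open>Degree -1 turns the homotopy space into the quotient of the morphisms from
  \<open>N\<close> to \<open>P\<close> by \<open>U\<close>, so it suffices that \<open>U\<close> is
  a proper subspace of a finite-dimensional space.\<close>

theorem dim_Kb_shift_pos:
  assumes fin: "V.fin_dim" and U: "U \<subset> carrier (Mor \<A> N P)" "\<zero>\<^bsub>Mor \<A> N P\<^esub> \<in> U"
    and U_add: "\<And>v w. v \<in> U \<Longrightarrow> w \<in> U \<Longrightarrow> v \<oplus>\<^bsub>Mor \<A> N P\<^esub> w \<in> U"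
    and U_smult: "\<And>c v. v \<in> U \<Longrightarrow> c \<odot>\<^bsub>Mor \<A> N P\<^esub> v \<in> U"
  shows "vectorspace.dim (class_ring :: complex ring) (Mor (Kb \<A>) T T') > 0"
proof -
  interpret W: quotient_vectorspace "chain_maps \<A> T T'" "null_homotopic \<A> T T'"
    unfolding null_homotopic_eq
  proof (rule quotient_vectorspace.intro)
    show "conc ` U \<subseteq> carrier (chain_maps \<A> T T')" unfolding chain_maps_carrier using U(1) by blast
    show "\<zero>\<^bsub>chain_maps \<A> T T'\<^esub> \<in> conc ` U" unfolding conc_zero using U(2) by blast
    show "v \<oplus>\<^bsub>chain_maps \<A> T T'\<^esub> w \<in> conc ` U" if "v \<in> conc ` U" "w \<in> conc ` U" for v w
      using that U_add conc_add by auto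
    show "c \<odot>\<^bsub>chain_maps \<A> T T'\<^esub> v \<in> conc ` U" if "v \<in> conc ` U" for c v
      using that U_smult conc_smult by auto
  qed (rule chain_maps_vectorspace)
  have Mor: "Mor (Kb \<A>) T T' = quot_module (chain_maps \<A> T T') (null_homotopic \<A> T T')"
    by (simp add: Kb_def quot_cat_def complex_cat_def)
  have fd: "vectorspace.fin_dim class_ring (chain_maps \<A> T T')"
    by (rule linear_map.surj_fin_dim[OF chain_maps_vectorspace(2) fin]) (simp add: chain_maps_carrier)
  have "null_homotopic \<A> T T' \<noteq> carrier (chain_maps \<A> T T')"
    unfolding null_homotopic_eq chain_maps_carrier using U(1) conc_inj by blast
  from dim_pos_if_surj_image[OF chain_maps_vectorspace(1) fd W.quot(2) W.carrier_quot W.quot_nontrivial[OF this]]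
  show ?thesis unfolding Mor .
qed

end

section \<open>Reduction modulo \<open>t\<close> at the vertex \<open>8\<close>\<close>

definition ev :: "(nat \<Rightarrow> complex fps mat) \<Rightarrow> complex mat" where
  "ev \<phi> = map_mat (\<lambda>a. fps_nth a 0) (\<phi> 8)"

lemma ev_carrier: "\<phi> \<in> carrier (qrep_hom 8 M N) \<Longrightarrow> ev \<phi> \<in> carrier_mat (rk N 8) (rk M 8)"
  using qrep_homD(1)[of \<phi> 8 M N 8] by (simp add: ev_def)

lemma ev_add:
  assumes "\<phi> \<in> carrier (qrep_hom 8 M N)" "\<psi> \<in> carrier (qrep_hom 8 M N)"
  shows "ev (\<phi> \<oplus>\<^bsub>qrep_hom 8 M N\<^esub> \<psi>) = ev \<phi> + ev \<psi>"
  using qrep_homD(1)[OF assms(1), of 8] qrep_homD(1)[OF assms(2), of 8]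
  by (auto simp: ev_def qrep_hom_add intro!: eq_matI)

lemma ev_smult:
  assumes "\<phi> \<in> carrier (qrep_hom 8 M N)"
  shows "ev (c \<odot>\<^bsub>qrep_hom 8 M N\<^esub> \<phi>) = c \<cdot>\<^sub>m ev \<phi>"
  using qrep_homD(1)[OF assms(1), of 8] by (auto simp: ev_def qrep_hom_smult intro!: eq_matI)

lemma ev_zero: "ev \<zero>\<^bsub>qrep_hom 8 M N\<^esub> = 0\<^sub>m (rk N 8) (rk M 8)"
  by (auto simp: ev_def qrep_hom_zero intro!: eq_matI)

lemma ev_qcomp:
  assumes "\<phi> \<in> carrier (qrep_hom 8 L M)" "\<psi> \<in> carrier (qrep_hom 8 M N)"
  shows "ev (qcomp 8 \<psi> \<phi>) = ev \<psi> * ev \<phi>"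
  using qrep_homD(1)[OF assms(1), of 8] qrep_homD(1)[OF assms(2), of 8]
  by (auto simp: ev_def scalar_prod_def fps_sum_nth intro!: eq_matI)

section \<open>The ideal of maps through projectives, and stable composition\<close>

lemma qcomp_proj_ideal:
  assumes s: "sized 8 L" "sized 8 M" "sized 8 N"
  shows "\<phi> \<in> proj_ideal 4 8 L M \<Longrightarrow> \<psi> \<in> carrier (qrep_hom 8 M N) \<Longrightarrow> qcomp 8 \<psi> \<phi> \<in> proj_ideal 4 8 L N"
    "\<phi> \<in> carrier (qrep_hom 8 L M) \<Longrightarrow> \<psi> \<in> proj_ideal 4 8 M N \<Longrightarrow> qcomp 8 \<psi> \<phi> \<in> proj_ideal 4 8 L N"
proof -
  assume "\<phi> \<in> proj_ideal 4 8 L M" and psi: "\<psi> \<in> carrier (qrep_hom 8 M N)"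
  then obtain Q \<alpha> \<beta> where Q: "CM_projective 4 8 Q" and al: "\<alpha> \<in> carrier (qrep_hom 8 L Q)"
    and be: "\<beta> \<in> carrier (qrep_hom 8 Q M)" and phi: "\<phi> = qcomp 8 \<beta> \<alpha>"
    unfolding proj_ideal_def Comp_CM_cat by blast
  have sQ: "sized 8 Q" using Q by (auto simp: CM_projective_def intro: sized_if_CM)
  have "qcomp 8 \<psi> \<phi> = qcomp 8 (qcomp 8 \<psi> \<beta>) \<alpha>" unfolding phi by (rule qcomp_assoc[OF al be psi])
  then show "qcomp 8 \<psi> \<phi> \<in> proj_ideal 4 8 L N"
    using Q al qcomp_hom[OF sQ s(2,3) be psi] unfolding proj_ideal_def Comp_CM_cat by blast
next
  assume phi: "\<phi> \<in> carrier (qrep_hom 8 L M)" and "\<psi> \<in> proj_ideal 4 8 M N"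
  then obtain Q \<alpha> \<beta> where Q: "CM_projective 4 8 Q" and al: "\<alpha> \<in> carrier (qrep_hom 8 M Q)"
    and be: "\<beta> \<in> carrier (qrep_hom 8 Q N)" and psi: "\<psi> = qcomp 8 \<beta> \<alpha>"
    unfolding proj_ideal_def Comp_CM_cat by blast
  have sQ: "sized 8 Q" using Q by (auto simp: CM_projective_def intro: sized_if_CM)
  have "qcomp 8 \<psi> \<phi> = qcomp 8 \<beta> (qcomp 8 \<alpha> \<phi>)" unfolding psi by (rule qcomp_assoc[OF phi al be, symmetric])
  then show "qcomp 8 \<psi> \<phi> \<in> proj_ideal 4 8 L N"
    using Q be qcomp_hom[OF s(1,2) sQ phi al] unfolding proj_ideal_def Comp_CM_cat by blast
qed

lemma proj_ideal_hom:
  assumes s: "sized 8 L" "sized 8 N" and "\<phi> \<in> proj_ideal 4 8 L N"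
  shows "\<phi> \<in> carrier (qrep_hom 8 L N)"
proof -
  from assms(3) obtain Q \<alpha> \<beta> where Q: "CM_projective 4 8 Q" and al: "\<alpha> \<in> carrier (qrep_hom 8 L Q)"
    and be: "\<beta> \<in> carrier (qrep_hom 8 Q N)" and phi: "\<phi> = qcomp 8 \<beta> \<alpha>"
    unfolding proj_ideal_def Comp_CM_cat by blast
  have sQ: "sized 8 Q" using Q by (auto simp: CM_projective_def intro: sized_if_CM)
  show ?thesis unfolding phi by (rule qcomp_hom[OF s(1) sQ s(2) al be])
qed

text \<open>This makes cosets nonempty. Composites in the quotient category are unions over
  representatives, and an empty factor would spoil them.\<close>

lemma proj_ideal_nonempty:
  assumes s: "sized 8 M" "sized 8 N"
  shows "proj_ideal 4 8 M N \<noteq> {}"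
proof -
  let ?Q = "P.proj 1"
  have "\<zero>\<^bsub>qrep_hom 8 M ?Q\<^esub> \<in> carrier (qrep_hom 8 M ?Q)"
    by (rule qrep_hom_zero_closed[OF s(1) sized_ds])
  moreover have "\<zero>\<^bsub>qrep_hom 8 ?Q N\<^esub> \<in> carrier (qrep_hom 8 ?Q N)"
    by (rule qrep_hom_zero_closed[OF sized_ds s(2)])
  ultimately show ?thesis
    using proj_projective[of 1] unfolding proj_ideal_def by blast
qed

lemma Mor_stable: "Mor (stable_CM 4 8) M N = quot_module (qrep_hom 8 M N) (proj_ideal 4 8 M N)"
  by (simp add: stable_CM_def quot_cat_def CM_cat_def)

lemma Comp_stable: "Comp (stable_CM 4 8) L M N G F =
    (\<Union>g\<in>G. \<Union>f\<in>F. proj_ideal 4 8 L N +>\<^bsub>qrep_hom 8 L N\<^esub> qcomp 8 g f)"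
  by (simp add: stable_CM_def quot_cat_def Comp_CM_cat) (simp add: CM_cat_def)

lemma carrier_stable: "carrier (Mor (stable_CM 4 8) M N) =
    (\<lambda>\<phi>. proj_ideal 4 8 M N +>\<^bsub>qrep_hom 8 M N\<^esub> \<phi>) ` carrier (qrep_hom 8 M N)"
  by (auto simp: Mor_stable quot_module_def A_RCOSETS_def')

text \<open>Matrices without rows or without columns are all equal, so the space of homomorphisms is
  a single point, which the nonempty ideal exhausts.\<close>

lemma stable_zero_space:
  assumes s: "sized 8 M" "sized 8 N" and z: "(\<forall>i. rk M i = 0) \<or> (\<forall>i. rk N i = 0)"
  shows "zero_space (Mor (stable_CM 4 8) M N)"
    "proj_ideal 4 8 M N = carrier (qrep_hom 8 M N)"
proof -
  let ?H = "qrep_hom 8 M N" and ?J = "proj_ideal 4 8 M N"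
  have all_eq: "\<phi> = \<psi>" if "\<phi> \<in> carrier ?H" "\<psi> \<in> carrier ?H" for \<phi> \<psi>
  proof (rule qrep_hom_ext[OF that])
    fix i :: nat assume i: "i \<in> {1..8}"
    show "\<phi> i = \<psi> i" using z qrep_homD(1)[OF that(1) i] qrep_homD(1)[OF that(2) i]
      by (intro eq_matI) auto
  qed
  obtain c where c: "c \<in> ?J" using proj_ideal_nonempty[OF s] by blast
  show J: "?J = carrier ?H"
    using proj_ideal_hom[OF s] all_eq[OF proj_ideal_hom[OF s c]] c by blast
  have vs: "vectorspace class_ring ?H" by (rule qrep_hom_vectorspace[OF s])
  interpret V: vectorspace "class_ring :: complex ring" ?H by (rule vs)
  interpret W: quotient_vectorspace ?H ?J
    by (rule quotient_vectorspace.intro[OF vs]; unfold J; (rule V.M.zero_closed V.M.a_closed V.smult_closed)?; auto?)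
  have "carrier (quot_module ?H ?J) = {?J +>\<^bsub>?H\<^esub> \<zero>\<^bsub>?H\<^esub>}"
    unfolding W.carrier_quot using all_eq[OF _ V.M.zero_closed] V.M.zero_closed by auto
  then show "zero_space (Mor (stable_CM 4 8) M N)"
    unfolding zero_space_def Mor_stable W.zero_quot using W.quot(1) by simp
qed

lemma stable_elem:
  assumes s: "sized 8 M" "sized 8 N" and G: "G \<in> carrier (Mor (stable_CM 4 8) M N)"
  shows "G \<noteq> {}" "g \<in> G \<Longrightarrow> g \<in> carrier (qrep_hom 8 M N)"
proof -
  from G obtain \<phi> where phi: "\<phi> \<in> carrier (qrep_hom 8 M N)"
    and G': "G = proj_ideal 4 8 M N +>\<^bsub>qrep_hom 8 M N\<^esub> \<phi>"
    unfolding carrier_stable by blast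
  show "G \<noteq> {}" using proj_ideal_nonempty[OF s] unfolding G' by (auto simp: a_r_coset_def')
  show "g \<in> G \<Longrightarrow> g \<in> carrier (qrep_hom 8 M N)"
    using qrep_hom_add_closed[OF s proj_ideal_hom[OF s] phi] unfolding G' by (auto simp: a_r_coset_def')
qed

text \<open>All members of the union defining the composite are cosets in a zero space, hence equal,
  and the union runs over nonempty sets.\<close>

lemma stable_comp_closed:
  assumes s: "sized 8 L" "sized 8 M" "sized 8 N"
    and G: "G \<in> carrier (Mor (stable_CM 4 8) M N)" and F: "F \<in> carrier (Mor (stable_CM 4 8) L M)"
    and z: "(\<forall>i. rk L i = 0) \<or> (\<forall>i. rk N i = 0)"
  shows "Comp (stable_CM 4 8) L M N G F \<in> carrier (Mor (stable_CM 4 8) L N)"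
proof -
  note zs = stable_zero_space(1)[OF s(1,3) z]
  have "proj_ideal 4 8 L N +>\<^bsub>qrep_hom 8 L N\<^esub> qcomp 8 g f = \<zero>\<^bsub>Mor (stable_CM 4 8) L N\<^esub>"
    if "g \<in> G" "f \<in> F" for g f
  proof -
    have "qcomp 8 g f \<in> carrier (qrep_hom 8 L N)"
      by (rule qcomp_hom[OF s stable_elem(2)[OF s(1,2) F that(2)] stable_elem(2)[OF s(2,3) G that(1)]])
    then have "proj_ideal 4 8 L N +>\<^bsub>qrep_hom 8 L N\<^esub> qcomp 8 g f \<in> carrier (Mor (stable_CM 4 8) L N)"
      unfolding carrier_stable by blast
    then show ?thesis using zero_spaceD(1)[OF zs] by blast
  qed
  then have "Comp (stable_CM 4 8) L M N G F = \<zero>\<^bsub>Mor (stable_CM 4 8) L N\<^esub>"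
    unfolding Comp_stable using stable_elem(1)[OF s(2,3) G] stable_elem(1)[OF s(1,2) F] by auto
  then show ?thesis using zero_spaceD(1)[OF zs] by blast
qed

section \<open>The presentation space of \<open>t g\<close>\<close>

locale tg =
  fixes t :: nat
  assumes t: "t > 0"
begin

definition Is :: "nat set list" where
  "Is = replicate t {1,2,4,5} @ replicate t {1,2,3,6}"

definition Js :: "nat set list" where
  "Js = replicate t {1,4,5,6} @ replicate t {1,2,6,7}"

abbreviation "H \<equiv> qrep_hom 8 (ds Is) (ds Js)"
abbreviation "J \<equiv> proj_ideal 4 8 (ds Is) (ds Js)"
abbreviation "V \<equiv> Mor (stable_CM 4 8) (ds Is) (ds Js)"
abbreviation "mats \<equiv> module_mat TYPE(complex) (2 * t) (2 * t)"

lemma len [simp]: "length Is = 2 * t" "length Js = 2 * t" by (simp_all add: Is_def Js_def)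

lemma Is_nth: "q < 2 * t \<Longrightarrow> Is ! q = (if q < t then {1,2,4,5} else {1,2,3,6})"
  and Js_nth: "q < 2 * t \<Longrightarrow> Js ! q = (if q < t then {1,4,5,6} else {1,2,6,7})"
  by (auto simp: Is_def Js_def nth_append)

lemma set_Is: "set Is \<subseteq> src_labels"
  unfolding Is_def set_append set_replicate_conv_if by (intro Un_least; split if_split; blast)

lemma set_Js: "set Js \<subseteq> tgt_labels"
  unfolding Js_def set_append set_replicate_conv_if by (intro Un_least; split if_split; blast)

lemma ev_H: "\<phi> \<in> carrier H \<Longrightarrow> ev \<phi> \<in> carrier_mat (2 * t) (2 * t)"
  using ev_carrier[of \<phi> "ds Is" "ds Js"] by simp

text \<open>The ideal becomes the kernel of the linear map \<open>ev\<close>, from which its closure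
  under addition can be read off.\<close>

lemma J_eq: "J = {\<phi> \<in> carrier H. ev \<phi> = 0\<^sub>m (2 * t) (2 * t)}"
proof (intro equalityI subsetI)
  fix \<phi> assume phi: "\<phi> \<in> J"
  then have h: "\<phi> \<in> carrier H" by (rule proj_ideal_hom[OF sized_ds sized_ds])
  have c: "\<phi> 8 \<in> carrier_mat (2 * t) (2 * t)" using qrep_homD(1)[OF h, of 8] by simp
  then have "ev \<phi> = 0\<^sub>m (2 * t) (2 * t)"
    using proj_ideal_coeff_zero[OF set_Is set_Js phi] by (intro eq_matI) (auto simp: ev_def)
  then show "\<phi> \<in> {\<phi> \<in> carrier H. ev \<phi> = 0\<^sub>m (2 * t) (2 * t)}" using h by simp
next
  fix \<phi> assume "\<phi> \<in> {\<phi> \<in> carrier H. ev \<phi> = 0\<^sub>m (2 * t) (2 * t)}"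
  then have h: "\<phi> \<in> carrier H" and e: "ev \<phi> = 0\<^sub>m (2 * t) (2 * t)" by auto
  have c: "\<phi> 8 \<in> carrier_mat (2 * t) (2 * t)" using qrep_homD(1)[OF h, of 8] by simp
  have "fps_nth (\<phi> 8 $$ (p, q)) 0 = 0" if "p < 2 * t" "q < 2 * t" for p q
    using arg_cong[OF e, of "\<lambda>A. A $$ (p, q)"] c that by (simp add: ev_def)
  then show "\<phi> \<in> J" by (intro proj_ideal_if_coeff_zero[OF set_Is set_Js h]) auto
qed

lemma H_vs: "vectorspace class_ring H" by (rule qrep_hom_vectorspace) simp_all

sublocale W: quotient_vectorspace H J
proof (rule quotient_vectorspace.intro[OF H_vs])
  interpret V: vectorspace "class_ring :: complex ring" H by (rule H_vs)
  show "J \<subseteq> carrier H" unfolding J_eq by blast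
  show "\<zero>\<^bsub>H\<^esub> \<in> J" unfolding J_eq by (simp add: ev_zero)
  show "\<phi> \<oplus>\<^bsub>H\<^esub> \<psi> \<in> J" if "\<phi> \<in> J" "\<psi> \<in> J" for \<phi> \<psi>
    using that V.M.a_closed unfolding J_eq by (auto simp: ev_add)
  show "c \<odot>\<^bsub>H\<^esub> \<phi> \<in> J" if "\<phi> \<in> J" for c \<phi>
    using that qrep_hom_smult_closed[OF sized_ds sized_ds] unfolding J_eq
    by (auto simp: ev_smult)
qed

definition cls :: "(nat \<Rightarrow> complex fps mat) \<Rightarrow> (nat \<Rightarrow> complex fps mat) set" where
  "cls \<phi> = J +>\<^bsub>H\<^esub> \<phi>"

lemma cls_eq_if:
  assumes h: "\<phi> \<in> carrier H" "\<psi> \<in> carrier H" and e: "ev \<phi> = ev \<psi>"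
  shows "cls \<phi> = cls \<psi>"
proof -
  have m: "(-1) \<odot>\<^bsub>H\<^esub> \<psi> \<in> carrier H" using h(2) by (rule W.smult_closed)
  let ?j = "\<phi> \<oplus>\<^bsub>H\<^esub> (-1) \<odot>\<^bsub>H\<^esub> \<psi>"
  have j: "?j \<in> J"
    unfolding J_eq using h m ev_H[OF h(2)] by (auto simp: ev_add ev_smult e intro!: eq_matI)
  have "(-1) \<odot>\<^bsub>H\<^esub> \<psi> \<oplus>\<^bsub>H\<^esub> \<psi> = \<zero>\<^bsub>H\<^esub>"
    using W.V.smult_l_distr[of "-1" 1 \<psi>] W.V.smult_one[OF h(2)] W.V.smult_l_null[OF h(2)] h(2) by simp
  then have "\<phi> = ?j \<oplus>\<^bsub>H\<^esub> \<psi>"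
    using h m by (simp add: W.V.M.a_assoc)
  then show ?thesis unfolding cls_def using W.coset_eq_iff[OF h] j by blast
qed

lemma cls_eqD:
  assumes h: "\<phi> \<in> carrier H" "\<psi> \<in> carrier H" and "cls \<phi> = cls \<psi>"
  shows "ev \<phi> = ev \<psi>"
proof -
  obtain j where "j \<in> J" "\<phi> = j \<oplus>\<^bsub>H\<^esub> \<psi>" using assms unfolding cls_def W.coset_eq_iff[OF h] by blast
  then show ?thesis using h ev_H[OF h(2)] unfolding J_eq by (auto simp: ev_add)
qed

lemma mem_cls_ev:
  assumes "\<phi> \<in> carrier H" "\<psi> \<in> cls \<phi>"
  shows "\<psi> \<in> carrier H" "ev \<psi> = ev \<phi>"
proof -
  obtain j where j: "j \<in> J" "\<psi> = j \<oplus>\<^bsub>H\<^esub> \<phi>" using assms(2) unfolding cls_def W.mem_coset by blast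
  then have "j \<in> carrier H" "ev j = 0\<^sub>m (2 * t) (2 * t)" unfolding J_eq by auto
  then show "\<psi> \<in> carrier H" "ev \<psi> = ev \<phi>"
    using assms(1) ev_H[OF assms(1)] j(2) by (auto simp: ev_add)
qed

text \<open>A section of \<open>ev\<close>, built from the shift 0 maps between source and target
  summands.\<close>

definition lift :: "complex mat \<Rightarrow> nat \<Rightarrow> complex fps mat" where
  "lift X = mono_hom 8 Is Js (\<lambda>_ _. 0) (map_mat fps_const X)"

lemma lift_hom: "lift X \<in> carrier H"
  unfolding lift_def
proof (rule mono_hom_hom)
  fix i p q :: nat assume *: "i \<le> 8" "p < length Js" "q < length Is"
  from bspec[OF bspec[OF bspec[OF cnt_src_tgt subsetD[OF set_Is nth_mem[OF *(3)]]] subsetD[OF set_Js nth_mem[OF *(2)]]], of i]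
  show "cnt (Js ! p) i \<le> 0 + cnt (Is ! q) i" using *(1) by simp
next
  fix p q :: nat assume *: "p < length Js" "q < length Is"
  from bspec[OF bspec[OF cnt_src subsetD[OF set_Is nth_mem[OF *(2)]]], of 8]
    bspec[OF bspec[OF cnt_tgt subsetD[OF set_Js nth_mem[OF *(1)]]], of 8]
  show "cnt (Js ! p) 8 = cnt (Is ! q) 8" by simp
qed

lemma ev_lift:
  assumes "X \<in> carrier_mat (2 * t) (2 * t)"
  shows "ev (lift X) = X"
proof (rule eq_matI)
  fix p q assume "p < dim_row X" "q < dim_col X"
  then have pq: "p < length Js" "q < length Is" using assms by auto
  from bspec[OF bspec[OF cnt_src subsetD[OF set_Is nth_mem[OF pq(2)]]], of 8]
    bspec[OF bspec[OF cnt_tgt subsetD[OF set_Js nth_mem[OF pq(1)]]], of 8]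
  have "cnt (Js ! p) 8 = 4" "cnt (Is ! q) 8 = 4" by simp_all
  then show "ev (lift X) $$ (p, q) = X $$ (p, q)"
    using pq assms by (simp add: ev_def lift_def mono_hom_def)
qed (use assms in \<open>auto simp: ev_def lift_def mono_hom_def\<close>)

lemma V_quot: "V = quot_module H J" by (rule Mor_stable)

lemma V_carrier: "carrier V = (\<lambda>X. cls (lift X)) ` carrier mats"
proof (intro equalityI subsetI)
  fix v assume "v \<in> carrier V"
  then obtain \<phi> where phi: "\<phi> \<in> carrier H" "v = cls \<phi>" unfolding V_quot W.carrier_quot cls_def by blast
  have "cls \<phi> = cls (lift (ev \<phi>))"
    by (rule cls_eq_if[OF phi(1) lift_hom]) (simp add: ev_lift[OF ev_H[OF phi(1)]])
  then have "v = cls (lift (ev \<phi>))" using phi(2) by simp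
  then show "v \<in> (\<lambda>X. cls (lift X)) ` carrier mats"
    using ev_H[OF phi(1)] by (auto simp: module_mat_simps)
next
  fix v assume "v \<in> (\<lambda>X. cls (lift X)) ` carrier mats"
  then show "v \<in> carrier V" unfolding V_quot W.carrier_quot cls_def using lift_hom by blast
qed

lemma cls_lift_add:
  assumes "X \<in> carrier mats" "Y \<in> carrier mats"
  shows "cls (lift X) \<oplus>\<^bsub>V\<^esub> cls (lift Y) = cls (lift (X \<oplus>\<^bsub>mats\<^esub> Y))"
proof -
  have "cls (lift X \<oplus>\<^bsub>H\<^esub> lift Y) = cls (lift (X + Y))"
    using assms
    by (intro cls_eq_if lift_hom W.V.M.a_closed) (auto simp: module_mat_simps ev_add[OF lift_hom lift_hom] ev_lift)
  then show ?thesis unfolding V_quot cls_def W.add_quot[OF lift_hom lift_hom] by (simp add: module_mat_simps)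
qed

lemma cls_lift_smult:
  assumes "X \<in> carrier mats"
  shows "c \<odot>\<^bsub>V\<^esub> cls (lift X) = cls (lift (c \<odot>\<^bsub>mats\<^esub> X))"
proof -
  have "cls (c \<odot>\<^bsub>H\<^esub> lift X) = cls (lift (c \<cdot>\<^sub>m X))"
    using assms
    by (intro cls_eq_if lift_hom W.smult_closed) (auto simp: module_mat_simps ev_smult[OF lift_hom] ev_lift)
  then show ?thesis unfolding V_quot cls_def W.smult_quot[OF lift_hom] by (simp add: module_mat_simps)
qed

lemma cls_lift_zero: "\<zero>\<^bsub>V\<^esub> = cls (lift \<zero>\<^bsub>mats\<^esub>)"
  unfolding V_quot W.zero_quot cls_def[symmetric]
  by (intro cls_eq_if lift_hom W.V.M.zero_closed) (auto simp: ev_zero ev_lift module_mat_simps)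

lemma V_vs: "vectorspace class_ring V"
  and V_fin: "vectorspace.fin_dim class_ring V"
proof -
  have *: "vectorspace class_ring V" "linear_map class_ring mats V (\<lambda>X. cls (lift X))"
    by (rule vectorspace_surj_image[OF matrix_vs V_carrier cls_lift_zero cls_lift_add cls_lift_smult]; assumption)+
  show "vectorspace class_ring V" by (rule *)
  show "vectorspace.fin_dim class_ring V"
    by (rule linear_map.surj_fin_dim[OF *(2) fin_dim_module_mat]) (rule V_carrier[symmetric])
qed

lemma cls_lift_inj:
  assumes "X \<in> carrier_mat (2 * t) (2 * t)" "Y \<in> carrier_mat (2 * t) (2 * t)" "cls (lift X) = cls (lift Y)"
  shows "X = Y"
  using cls_eqD[OF lift_hom lift_hom assms(3)] assms by (simp add: ev_lift)

text \<open>For each ordered pair of different summands some vertex has a larger count at the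
  target, which excludes a constant term. For the sources, vertex 3 separates
  \<open>{1,2,4,5}\<close> (count 2) from \<open>{1,2,3,6}\<close> (count 3), and vertex 5 reverses
  the order (4 against 3). For the targets \<open>{1,4,5,6}\<close> and \<open>{1,2,6,7}\<close>,
  vertices 2 and 6 do the same, with counts 1 against 2 and 4 against 3.\<close>

lemma End_block_diag:
  shows "\<alpha> \<in> carrier (qrep_hom 8 (ds Is) (ds Is)) \<Longrightarrow> block_diag t (ev \<alpha>)"
    "\<beta> \<in> carrier (qrep_hom 8 (ds Js) (ds Js)) \<Longrightarrow> block_diag t (ev \<beta>)"
proof -
  assume al: "\<alpha> \<in> carrier (qrep_hom 8 (ds Is) (ds Is))"
  have "fps_nth (\<alpha> 8 $$ (p, q)) 0 = 0" if pq: "p < 2 * t" "q < 2 * t" "(p < t) \<noteq> (q < t)" for p q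
  proof (rule coeff_zero_if_cnt_less[OF al])
    show "cnt (Is ! q) (if q < t then 3 else 5) < cnt (Is ! p) (if q < t then 3 else 5)"
      using pq by (auto simp: Is_nth cnt_numeral)
  qed (use pq in auto)
  then show "block_diag t (ev \<alpha>)"
    using ev_carrier[OF al] qrep_homD(1)[OF al, of 8] by (auto simp: block_diag_def ev_def)
next
  assume be: "\<beta> \<in> carrier (qrep_hom 8 (ds Js) (ds Js))"
  have "fps_nth (\<beta> 8 $$ (p, q)) 0 = 0" if pq: "p < 2 * t" "q < 2 * t" "(p < t) \<noteq> (q < t)" for p q
  proof (rule coeff_zero_if_cnt_less[OF be])
    show "cnt (Js ! q) (if q < t then 2 else 6) < cnt (Js ! p) (if q < t then 2 else 6)"
      using pq by (auto simp: Js_nth cnt_numeral)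
  qed (use pq in auto)
  then show "block_diag t (ev \<beta>)"
    using ev_carrier[OF be] qrep_homD(1)[OF be, of 8] by (auto simp: block_diag_def ev_def)
qed

text \<open>Changing \<open>a\<close> by an element \<open>j\<close> of the ideal changes
  \<open>ev g * ev a\<close> by \<open>ev g * ev j\<close>. The composite of \<open>g\<close> with
  \<open>j\<close> lies in \<open>J\<close>, which is the kernel of \<open>ev\<close>, so this
  product vanishes although nothing is claimed about \<open>ev j\<close> itself. The proof of
  \<open>comp_postcompose\<close> is symmetric.\<close>

lemma comp_precompose:
  assumes g: "g \<in> carrier H" and a: "a \<in> carrier (qrep_hom 8 (ds Is) (ds Is))"
  shows "Comp (stable_CM 4 8) (ds Is) (ds Is) (ds Js) (cls g)
      (proj_ideal 4 8 (ds Is) (ds Is) +>\<^bsub>qrep_hom 8 (ds Is) (ds Is)\<^esub> a) = cls (qcomp 8 g a)"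
proof -
  let ?E = "qrep_hom 8 (ds Is) (ds Is)" and ?I = "proj_ideal 4 8 (ds Is) (ds Is)"
  have A: "?I +>\<^bsub>?E\<^esub> a \<in> carrier (Mor (stable_CM 4 8) (ds Is) (ds Is))"
    unfolding carrier_stable using a by blast
  have G: "cls g \<in> carrier V" unfolding carrier_stable cls_def using g by blast
  have "cls (qcomp 8 g' a') = cls (qcomp 8 g a)" if g': "g' \<in> cls g" and a': "a' \<in> ?I +>\<^bsub>?E\<^esub> a" for g' a'
  proof -
    note gh = mem_cls_ev[OF g g'] and ah = stable_elem(2)[OF sized_ds sized_ds A a']
    obtain j where j: "j \<in> ?I" "a' = j \<oplus>\<^bsub>?E\<^esub> a" using a' by (auto simp: a_r_coset_def')
    have jh: "j \<in> carrier ?E" by (rule proj_ideal_hom[OF sized_ds sized_ds j(1)])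
    have "qcomp 8 g j \<in> J" by (rule qcomp_proj_ideal(1)[OF sized_ds sized_ds sized_ds j(1) g])
    then have z: "ev g * ev j = 0\<^sub>m (2 * t) (2 * t)" using ev_qcomp[OF jh g] unfolding J_eq by simp
    have c: "ev g \<in> carrier_mat (2 * t) (2 * t)" "ev j \<in> carrier_mat (2 * t) (2 * t)" "ev a \<in> carrier_mat (2 * t) (2 * t)"
      using ev_H[OF g] ev_carrier[OF jh] ev_carrier[OF a] by simp_all
    have "ev g * ev a' = ev g * ev a"
      unfolding j(2) ev_add[OF jh a] mult_add_distrib_mat[OF c] z using c by simp
    then have "ev (qcomp 8 g' a') = ev (qcomp 8 g a)"
      unfolding ev_qcomp[OF ah gh(1)] ev_qcomp[OF a g] gh(2) .
    then show ?thesis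
      by (rule cls_eq_if[OF qcomp_hom[OF sized_ds sized_ds sized_ds ah gh(1)]
          qcomp_hom[OF sized_ds sized_ds sized_ds a g]])
  qed
  moreover have "cls g \<noteq> {}" "?I +>\<^bsub>?E\<^esub> a \<noteq> {}"
    using stable_elem(1)[OF sized_ds sized_ds] A G by blast+
  ultimately show ?thesis unfolding Comp_stable cls_def[symmetric] by blast
qed

lemma comp_postcompose:
  assumes g: "g \<in> carrier H" and b: "b \<in> carrier (qrep_hom 8 (ds Js) (ds Js))"
  shows "Comp (stable_CM 4 8) (ds Is) (ds Js) (ds Js)
      (proj_ideal 4 8 (ds Js) (ds Js) +>\<^bsub>qrep_hom 8 (ds Js) (ds Js)\<^esub> b) (cls g) = cls (qcomp 8 b g)"
proof -
  let ?E = "qrep_hom 8 (ds Js) (ds Js)" and ?I = "proj_ideal 4 8 (ds Js) (ds Js)"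
  have B: "?I +>\<^bsub>?E\<^esub> b \<in> carrier (Mor (stable_CM 4 8) (ds Js) (ds Js))"
    unfolding carrier_stable using b by blast
  have G: "cls g \<in> carrier V" unfolding carrier_stable cls_def using g by blast
  have "cls (qcomp 8 b' g') = cls (qcomp 8 b g)" if g': "g' \<in> cls g" and b': "b' \<in> ?I +>\<^bsub>?E\<^esub> b" for g' b'
  proof -
    note gh = mem_cls_ev[OF g g'] and bh = stable_elem(2)[OF sized_ds sized_ds B b']
    obtain j where j: "j \<in> ?I" "b' = j \<oplus>\<^bsub>?E\<^esub> b" using b' by (auto simp: a_r_coset_def')
    have jh: "j \<in> carrier ?E" by (rule proj_ideal_hom[OF sized_ds sized_ds j(1)])
    have "qcomp 8 j g \<in> J" by (rule qcomp_proj_ideal(2)[OF sized_ds sized_ds sized_ds g j(1)])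
    then have z: "ev j * ev g = 0\<^sub>m (2 * t) (2 * t)" using ev_qcomp[OF g jh] unfolding J_eq by simp
    have c: "ev j \<in> carrier_mat (2 * t) (2 * t)" "ev b \<in> carrier_mat (2 * t) (2 * t)" "ev g \<in> carrier_mat (2 * t) (2 * t)"
      using ev_H[OF g] ev_carrier[OF jh] ev_carrier[OF b] by simp_all
    have "ev b' * ev g = ev b * ev g"
      unfolding j(2) ev_add[OF jh b] add_mult_distrib_mat[OF c] z using c by simp
    then have "ev (qcomp 8 b' g') = ev (qcomp 8 b g)"
      unfolding ev_qcomp[OF gh(1) bh] ev_qcomp[OF g b] gh(2) .
    then show ?thesis
      by (rule cls_eq_if[OF qcomp_hom[OF sized_ds sized_ds sized_ds gh(1) bh]
          qcomp_hom[OF sized_ds sized_ds sized_ds g b]])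
  qed
  moreover have "cls g \<noteq> {}" "?I +>\<^bsub>?E\<^esub> b \<noteq> {}"
    using stable_elem(1)[OF sized_ds sized_ds] B G by blast+
  ultimately show ?thesis unfolding Comp_stable cls_def[symmetric] by blast
qed

lemma cls_in_V: "\<phi> \<in> carrier H \<Longrightarrow> cls \<phi> \<in> carrier V"
  unfolding carrier_stable cls_def by blast

text \<open>The category is left general because \<open>add_cat\<close> differs from the stable
  category in its set of objects only; morphism spaces and composition are the same.\<close>

theorem dim_shift_pos:
  assumes A: "Mor \<A> = Mor (stable_CM 4 8)" "Comp \<A> = Comp (stable_CM 4 8)" and f: "f \<in> carrier V"
  shows "vectorspace.dim (class_ring :: complex ring) (Mor (Kb \<A>) (two_term \<A> (ds []) (ds Is) (ds Js) f)
    (shift \<A> (two_term \<A> (ds []) (ds Is) (ds Js) f))) > 0"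
proof -
  let ?S = "stable_CM 4 8" and ?EI = "qrep_hom 8 (ds Is) (ds Is)" and ?EJ = "qrep_hom 8 (ds Js) (ds Js)"
  obtain f0 where f0: "f0 \<in> carrier H" "f = cls f0" using f unfolding carrier_stable cls_def by blast
  define F where "F = ev f0"
  have F: "F \<in> carrier_mat (2 * t) (2 * t)" unfolding F_def by (rule ev_H[OF f0(1)])
  interpret C: two_term_complex \<A> "ds []" "ds Is" "ds Js" f
  proof (rule two_term_complex.intro, unfold A)
    fix X assume "X \<in> {ds [], ds Is, ds Js}"
    then have "sized 8 X" by (elim insertE emptyE) (simp_all only: sized_ds)
    then show "zero_space (Mor ?S X (ds []))" "zero_space (Mor ?S (ds []) X)"
      by (intro stable_zero_space(1) sized_ds; simp only: rk_ds list.size simp_thms)+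
  next
    fix X Y W G K
    assume X: "X \<in> {ds [], ds Is, ds Js}" and Y: "Y \<in> {ds [], ds Is, ds Js}" and W: "W \<in> {ds [], ds Is, ds Js}"
      and c: "X = ds [] \<or> W = ds [] \<or> X = ds Is \<and> W = ds Js \<and> Y \<noteq> ds []"
      and K: "K \<in> carrier (Mor ?S X Y)" and G: "G \<in> carrier (Mor ?S Y W)"
    have s: "sized 8 X" "sized 8 Y" "sized 8 W"
      using X Y W by (elim insertE emptyE; simp only: sized_ds)+
    consider "X = ds [] \<or> W = ds []" | "X = ds Is" "W = ds Js" "Y = ds Is" | "X = ds Is" "W = ds Js" "Y = ds Js"
      using c Y by blast
    then show "Comp ?S X Y W G K \<in> carrier (Mor ?S X W)"
    proof cases
      case 1
      then show ?thesis
        by (intro stable_comp_closed[OF s G K]) (elim disjE; simp only: rk_ds list.size simp_thms)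
    next
      case 2
      then obtain g a where "g \<in> carrier H" "G = cls g" "a \<in> carrier ?EI" "K = proj_ideal 4 8 (ds Is) (ds Is) +>\<^bsub>?EI\<^esub> a"
        using G K unfolding carrier_stable cls_def by blast
      then show ?thesis using 2
        by (simp only: comp_precompose) (rule cls_in_V[OF qcomp_hom[OF sized_ds sized_ds sized_ds]])
    next
      case 3
      then obtain g b where "g \<in> carrier H" "K = cls g" "b \<in> carrier ?EJ" "G = proj_ideal 4 8 (ds Js) (ds Js) +>\<^bsub>?EJ\<^esub> b"
        using G K unfolding carrier_stable cls_def by blast
      then show ?thesis using 3
        by (simp only: comp_postcompose) (rule cls_in_V[OF qcomp_hom[OF sized_ds sized_ds sized_ds]])
    qed
  qed (rule V_vs f)+
  define U0 where "U0 = {ev b * F - F * ev a | a b. a \<in> carrier ?EI \<and> b \<in> carrier ?EJ}"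
  \<comment> \<open>A representative of \<open>-f\<close>, the differential of the shifted complex,
    on which \<open>ev\<close> can be evaluated.\<close>
  define m where "m = (-1) \<odot>\<^bsub>H\<^esub> f0"
  have m: "m \<in> carrier H" "ev m = (-1) \<cdot>\<^sub>m F"
    unfolding m_def F_def using f0(1) by (auto simp: W.smult_closed ev_smult)
  have neg: "\<ominus>\<^bsub>V\<^esub> f = cls m"
  proof -
    interpret V: vectorspace "class_ring :: complex ring" V by (rule V_vs)
    have "\<ominus>\<^bsub>V\<^esub> f = (-1) \<odot>\<^bsub>V\<^esub> f" using V.smult_minus_1[OF f] by (simp add: class_ring_simps)
    then show ?thesis
      unfolding f0(2) cls_def m_def V_quot W.smult_quot[OF f0(1)] .
  qed
  have cI: "ev a \<in> carrier_mat (2 * t) (2 * t)" if "a \<in> carrier ?EI" for a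
    using ev_carrier[OF that] by simp
  have cJ: "ev b \<in> carrier_mat (2 * t) (2 * t)" if "b \<in> carrier ?EJ" for b
    using ev_carrier[OF that] by simp
  have sum: "cls (qcomp 8 m a) \<oplus>\<^bsub>V\<^esub> cls (qcomp 8 b f0) = cls (lift (ev b * F - F * ev a))"
    if a: "a \<in> carrier ?EI" and b: "b \<in> carrier ?EJ" for a b
  proof -
    have h: "qcomp 8 m a \<in> carrier H" "qcomp 8 b f0 \<in> carrier H"
      by (rule qcomp_hom[OF sized_ds sized_ds sized_ds] a b m(1) f0(1))+
    have FA: "F * ev a \<in> carrier_mat (2 * t) (2 * t)" and BF: "ev b * F \<in> carrier_mat (2 * t) (2 * t)"
      by (rule mult_carrier_mat[OF F cI[OF a]] mult_carrier_mat[OF cJ[OF b] F])+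
    have "ev (qcomp 8 m a \<oplus>\<^bsub>H\<^esub> qcomp 8 b f0) = (-1) \<cdot>\<^sub>m (F * ev a) + ev b * F"
      unfolding ev_add[OF h] ev_qcomp[OF a m(1)] ev_qcomp[OF f0(1) b] m(2) F_def[symmetric]
        mult_smult_assoc_mat[OF F cI[OF a]] ..
    also have "\<dots> = ev b * F - F * ev a"
      by (rule neg_smult_add_mat[OF FA BF])
    also have "\<dots> = ev (lift (ev b * F - F * ev a))"
      by (rule ev_lift[symmetric]) (rule minus_carrier_mat[OF FA])
    finally have "cls (qcomp 8 m a \<oplus>\<^bsub>H\<^esub> qcomp 8 b f0) = cls (lift (ev b * F - F * ev a))"
      by (intro cls_eq_if lift_hom W.V.M.a_closed h)
    then show ?thesis unfolding V_quot cls_def W.add_quot[OF h] .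
  qed
  have U: "C.U = (\<lambda>X. cls (lift X)) ` U0"
  proof (intro equalityI subsetI)
    fix u assume "u \<in> C.U"
    then obtain a b where "a \<in> carrier ?EI" "b \<in> carrier ?EJ"
      "u = Comp ?S (ds Is) (ds Is) (ds Js) (cls m) (proj_ideal 4 8 (ds Is) (ds Is) +>\<^bsub>?EI\<^esub> a) \<oplus>\<^bsub>V\<^esub>
         Comp ?S (ds Is) (ds Js) (ds Js) (proj_ideal 4 8 (ds Js) (ds Js) +>\<^bsub>?EJ\<^esub> b) (cls f0)"
      unfolding C.U_def A neg f0(2)[symmetric] carrier_stable by blast
    then show "u \<in> (\<lambda>X. cls (lift X)) ` U0"
      unfolding U0_def by (auto simp only: comp_precompose[OF m(1)] comp_postcompose[OF f0(1)] sum)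
  next
    fix u assume "u \<in> (\<lambda>X. cls (lift X)) ` U0"
    then obtain a b where ab: "a \<in> carrier ?EI" "b \<in> carrier ?EJ" and "u = cls (lift (ev b * F - F * ev a))"
      unfolding U0_def by blast
    then have "u = Comp ?S (ds Is) (ds Is) (ds Js) (cls m) (proj_ideal 4 8 (ds Is) (ds Is) +>\<^bsub>?EI\<^esub> a) \<oplus>\<^bsub>V\<^esub>
         Comp ?S (ds Is) (ds Js) (ds Js) (proj_ideal 4 8 (ds Js) (ds Js) +>\<^bsub>?EJ\<^esub> b) (cls f0)"
      by (simp only: comp_precompose[OF m(1)] comp_postcompose[OF f0(1)] sum)
    then show "u \<in> C.U"
      unfolding C.U_def A neg f0(2)[symmetric] carrier_stable using ab by blast
  qed
  have U0_sub: "U0 \<subseteq> carrier_mat (2 * t) (2 * t)"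
    unfolding U0_def using F cI by (auto intro!: minus_carrier_mat mult_carrier_mat)
  have U0_zero: "0\<^sub>m (2 * t) (2 * t) \<in> U0"
  proof -
    have "0\<^sub>m (2 * t) (2 * t) = ev \<zero>\<^bsub>?EJ\<^esub> * F - F * ev \<zero>\<^bsub>?EI\<^esub>"
      using F by (auto simp: ev_zero intro!: eq_matI)
    then show ?thesis unfolding U0_def using qrep_hom_zero_closed[OF sized_ds sized_ds] by blast
  qed
  have U0_add: "X + Y \<in> U0" if X: "X \<in> U0" and Y: "Y \<in> U0" for X Y
  proof -
    obtain a b a' b' where ab: "a \<in> carrier ?EI" "b \<in> carrier ?EJ" "a' \<in> carrier ?EI" "b' \<in> carrier ?EJ"
      and XY: "X = ev b * F - F * ev a" "Y = ev b' * F - F * ev a'" using X Y unfolding U0_def by blast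
    note c = cI[OF ab(1)] cJ[OF ab(2)] cI[OF ab(3)] cJ[OF ab(4)]
    note p = mult_carrier_mat[OF F c(1)] mult_carrier_mat[OF c(2) F] mult_carrier_mat[OF F c(3)] mult_carrier_mat[OF c(4) F]
    have "X + Y = (ev b * F + ev b' * F) - (F * ev a + F * ev a')"
      unfolding XY by (rule add_minus_interchange_mat[OF p(2,4,1,3), symmetric])
    also have "\<dots> = ev (b \<oplus>\<^bsub>?EJ\<^esub> b') * F - F * ev (a \<oplus>\<^bsub>?EI\<^esub> a')"
      unfolding ev_add[OF ab(1,3)] ev_add[OF ab(2,4)]
        add_mult_distrib_mat[OF c(2,4) F] mult_add_distrib_mat[OF F c(1,3)] ..
    finally show ?thesis
      unfolding U0_def using qrep_hom_add_closed[OF sized_ds sized_ds] ab by blast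
  qed
  have U0_smult: "x \<cdot>\<^sub>m X \<in> U0" if X: "X \<in> U0" for x X
  proof -
    obtain a b where ab: "a \<in> carrier ?EI" "b \<in> carrier ?EJ"
      and X: "X = ev b * F - F * ev a" using X unfolding U0_def by blast
    note c = cI[OF ab(1)] cJ[OF ab(2)]
    note p = mult_carrier_mat[OF F c(1)] mult_carrier_mat[OF c(2) F]
    have "x \<cdot>\<^sub>m X = x \<cdot>\<^sub>m (ev b * F) - x \<cdot>\<^sub>m (F * ev a)"
      unfolding X by (rule smult_minus_distrib_mat[OF p(2,1)])
    also have "\<dots> = ev (x \<odot>\<^bsub>?EJ\<^esub> b) * F - F * ev (x \<odot>\<^bsub>?EI\<^esub> a)"
      unfolding ev_smult[OF ab(1)] ev_smult[OF ab(2)]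
        mult_smult_assoc_mat[OF c(2) F] mult_smult_distrib[OF F c(1)] ..
    finally show ?thesis
      unfolding U0_def using qrep_hom_smult_closed[OF sized_ds sized_ds] ab by blast
  qed
  \<comment> \<open>Endomorphisms yield block diagonal pairs, so \<open>X\<close> lies outside
    \<open>U0\<close>. By injectivity on matrices the class of its lift lies outside
    \<open>C.U\<close>.\<close>
  obtain X where X: "X \<in> carrier_mat (2 * t) (2 * t)"
    "\<And>a b. block_diag t a \<Longrightarrow> block_diag t b \<Longrightarrow> b * F - F * a \<noteq> X"
    using block_diag_commutators_not_surj[OF F t] by blast
  then have "X \<notin> U0" unfolding U0_def using End_block_diag by blast
  then have "cls (lift X) \<notin> C.U" unfolding U using cls_lift_inj[OF X(1)] U0_sub by blast
  moreover have "cls (lift X) \<in> carrier V" by (rule cls_in_V[OF lift_hom])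
  moreover have "C.U \<subseteq> carrier V" unfolding U by (auto intro!: cls_in_V lift_hom)
  ultimately have psub: "C.U \<subset> carrier V" by blast
  have sub: "X \<in> carrier mats" if "X \<in> U0" for X using U0_sub that by (auto simp: module_mat_simps)
  show ?thesis
  proof (rule C.dim_Kb_shift_pos, unfold A)
    show "vectorspace.fin_dim class_ring V" by (rule V_fin)
    show "C.U \<subset> carrier V" by (rule psub)
    show "\<zero>\<^bsub>V\<^esub> \<in> C.U" unfolding U cls_lift_zero using U0_zero by (auto simp: module_mat_simps)
    show "v \<oplus>\<^bsub>V\<^esub> w \<in> C.U" if vw: "v \<in> C.U" "w \<in> C.U" for v w
    proof -
      obtain X Y where XY: "X \<in> U0" "Y \<in> U0" "v = cls (lift X)" "w = cls (lift Y)" using vw unfolding U by blast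
      then have "v \<oplus>\<^bsub>V\<^esub> w = cls (lift (X + Y))" using cls_lift_add[OF sub sub] by (simp add: module_mat_simps)
      then show ?thesis unfolding U using U0_add[OF XY(1,2)] by blast
    qed
    show "x \<odot>\<^bsub>V\<^esub> v \<in> C.U" if v: "v \<in> C.U" for x v
    proof -
      obtain X where XY: "X \<in> U0" "v = cls (lift X)" using v unfolding U by blast
      then have "x \<odot>\<^bsub>V\<^esub> v = cls (lift (x \<cdot>\<^sub>m X))" using cls_lift_smult[OF sub] by (simp add: module_mat_simps)
      then show ?thesis unfolding U using U0_smult[OF XY(1)] by blast
    qed
  qed
qed

section \<open>The two terms of the complex for the multiples of the given vector\<close>

lemma g_coords: "map (\<lambda>I. int t * g_coord I) T_labels = map ((*) (int t)) [0, -1, 0, -1, 0, 1, 0, 1, 0]"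
proof -
  have "map g_coord T_labels = [0, -1, 0, -1, 0, 1, 0, 1, 0]"
    by (simp add: T_labels_def g_coord_def set_eq_subset)
  from arg_cong[OF this, of "map ((*) (int t))"] show ?thesis by (simp add: comp_def)
qed

lemma T_neg_eq:
  "T_neg (map rank_one T_labels) (map (\<lambda>I. int t * g_coord I) T_labels) = ds Is"
  unfolding g_coords by (simp add: T_neg_def T_labels_def Is_def)

lemma T_pos_eq:
  "T_pos (map rank_one T_labels) (map (\<lambda>I. int t * g_coord I) T_labels) = ds Js"
  unfolding g_coords by (simp add: T_pos_def T_labels_def Js_def)

end

theorem proposition4p7:
  fixes t :: nat
  assumes "t > 0"
  shows "e_inv 4 8 (map rank_one T_labels) (map (\<lambda>I. int t * g_coord I) T_labels) > 0"
proof -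
  interpret tg t by unfold_locales (rule assms)
  let ?Ts = "map rank_one T_labels" and ?g = "map (\<lambda>I. int t * g_coord I) T_labels"
  have "E_dim 4 8 ?Ts ?g f > 0" if "f \<in> carrier V" for f
    unfolding E_dim_def T_cx_def T_neg_eq T_pos_eq
    using dim_shift_pos[of "add_cat 4 8 (dsum ?Ts)", OF _ _ that]
    by (simp add: add_cat_def full_subcat_def)
  \<comment> \<open>An infimum of natural numbers over a nonempty set is attained, so positivity of
    all values suffices; any lifted matrix shows that the set is nonempty.\<close>
  moreover have "e_inv 4 8 ?Ts ?g \<in> E_dim 4 8 ?Ts ?g ` carrier V"
    unfolding e_inv_def T_neg_eq T_pos_eq
    by (rule Inf_nat_def1) (use cls_in_V[OF lift_hom] in blast)
  ultimately show ?thesis by auto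
qed

end
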